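(* Let $E$ be a smooth and uniformly convex real Banach space, $C$ a nonempty closed convex subset of $E$, $\{S_n\}$ a sequence of mappings of $C$ into $E$ such that $F = \bigcap_{n=1}^\infty F(S_n)$ is nonempty, and $\{\alpha_n\}$ a sequence in $[0,1]$ such that $\alpha_n \to 0$. Let $u$ be a point in $E$ and $\{x_n\}$ a sequence defined by $x_1 \in C$ and $$x_{n+1}= Q_C J^{-1}\bigl( \alpha_n J u + (1-\alpha_n)J S_n x_n \bigr)$$ for $n\in\mathbb{N}$. Suppose that (i) $\{S_n\}$ is a strongly relatively nonexpansive sequence; (ii) $\{S_n\}$ satisfies the condition (Z); (iii) $\alpha_n > 0$ for every $n\in \mathbb{N}$ and $\sum_{n=1}^\infty \alpha_n = \infty$. Then $\{x_n\}$ converges strongly to $w=Q_F(u)$.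
   Context: $E^*$ is the dual of $E$, $\langle x, x^*\rangle$ is the value of $x^*\in E^*$ at $x\in E$, and $\mathbb{N}$ is the set of positive integers. The (normalized) duality mapping $J$ of $E$ is $Jx=\{x^*\in E^*: \langle x,x^*\rangle=\|x\|^2=\|x^*\|^2\}$; when $E$ is smooth, strictly convex and reflexive (in particular smooth and uniformly convex) $J$ is a single-valued bijection of $E$ onto $E^*$, and $J^{-1}$ is its inverse. Define $\phi(x,y)=\|x\|^2-2\langle x,Jy\rangle+\|y\|^2$ for $x,y\in E$. For a nonempty closed convex subset $D$ of $E$ and $x\in E$, $Q_D(x)$ denotes the unique point $x_0\in D$ with $\phi(x_0,x)=\min\{\phi(y,x): y\in D\}$; $Q_D$ is the generalized projection of $E$ onto $D$. For a mapping $T\colon C\to E$, $F(T)=\{x\in C: Tx=x\}$. $T$ is of type (r) if $F(T)\neq\emptyset$ and $\phi(p,Tx)\le\phi(p,x)$ for all $x\in C$ and $p\in F(T)$; in that case $F(T)$ is closed and convex. Let $\{T_n\}$ be a sequence of mappings of $C$ into $E$ with $F=\bigcap_{n=1}^\infty F(T_n)\ne\emptyset$. $\{T_n\}$ is a strongly relatively nonexpansive sequence if each $T_n$ is of type (r) and $\phi(T_nx_n,x_n)\to0$ whenever $\{x_n\}$ is a bounded sequence in $C$ and $\phi(p,x_n)-\phi(p,T_nx_n)\to 0$ for some $p\in F$. $\{T_n\}$ satisfies the condition (Z) if every weak cluster point of $\{x_n\}$ (weak limit of a subsequence) belongs to $F$ whenever $\{x_n\}$ is a bounded sequence in $C$ such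 that $T_nx_n-x_n\to0$. *)

theory Defs
  imports "HOL-Analysis.Analysis"
begin

text \<open>
  The Banach space is the carrier of a type of class \<open>banach\<close>, and its dual is the
  type of bounded linear functionals with the operator norm. A mapping of a subset \<open>C\<close>
  into the space is a total function of which only the values on \<open>C\<close> are used. Sequences are
  indexed by the positive integers, so their values at \<open>0\<close> are never constrained.
\<close>

definition smooth_space :: "'a::real_normed_vector itself \<Rightarrow> bool" where
  "smooth_space _ \<longleftrightarrow>
     (\<forall>x y :: 'a. norm x = 1 \<longrightarrow> norm y = 1 \<longrightarrow>
        (\<exists>l. ((\<lambda>t::real. (norm (x + t *\<^sub>R y) - norm x) / t) \<longlongrightarrow> l) (at 0)))"

definition uniformly_convex_space :: "'a::real_normed_vector itself \<Rightarrow> bool" where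
  "uniformly_convex_space _ \<longleftrightarrow>
     (\<forall>e>0. \<exists>d>0. \<forall>x y :: 'a.
        norm x = 1 \<longrightarrow> norm y = 1 \<longrightarrow> norm (x - y) \<ge> e \<longrightarrow> norm ((1/2) *\<^sub>R (x + y)) \<le> 1 - d)"

definition duality_set :: "'a::real_normed_vector \<Rightarrow> ('a \<Rightarrow>\<^sub>L real) set" where
  "duality_set x = {f. blinfun_apply f x = (norm x)\<^sup>2 \<and> (norm x)\<^sup>2 = (norm f)\<^sup>2}"

text \<open>
  The duality mapping as a point-valued map. It is meaningful when every \<^const>\<open>duality_set\<close>
  is a singleton. In a smooth, strictly convex and reflexive space that is the case, and
  the map is then a bijection onto the dual, with inverse \<open>inv duality_map\<close>.
\<close>

definition duality_map :: "'a::real_normed_vector \<Rightarrow> ('a \<Rightarrow>\<^sub>L real)" where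
  "duality_map x = (THE f. f \<in> duality_set x)"

definition phi :: "'a::real_normed_vector \<Rightarrow> 'a \<Rightarrow> real" where
  "phi x y = (norm x)\<^sup>2 - 2 * blinfun_apply (duality_map y) x + (norm y)\<^sup>2"

definition gen_proj :: "'a::real_normed_vector set \<Rightarrow> 'a \<Rightarrow> 'a" where
  "gen_proj D x = (THE z. z \<in> D \<and> (\<forall>y\<in>D. phi z x \<le> phi y x))"

definition fixed_points :: "'a set \<Rightarrow> ('a \<Rightarrow> 'a) \<Rightarrow> 'a set" where
  "fixed_points C T = {x \<in> C. T x = x}"

definition common_fixed_points :: "'a set \<Rightarrow> (nat \<Rightarrow> 'a \<Rightarrow> 'a) \<Rightarrow> 'a set" where
  "common_fixed_points C T = (\<Inter>n\<in>{1..}. fixed_points C (T n))"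

definition type_r :: "'a::real_normed_vector set \<Rightarrow> ('a \<Rightarrow> 'a) \<Rightarrow> bool" where
  "type_r C T \<longleftrightarrow>
     fixed_points C T \<noteq> {} \<and>
     (\<forall>x\<in>C. \<forall>p\<in>fixed_points C T. phi p (T x) \<le> phi p x)"

definition strongly_relatively_nonexpansive_seq ::
    "'a::real_normed_vector set \<Rightarrow> (nat \<Rightarrow> 'a \<Rightarrow> 'a) \<Rightarrow> bool" where
  "strongly_relatively_nonexpansive_seq C T \<longleftrightarrow>
     (\<forall>n\<ge>1. type_r C (T n)) \<and>
     (\<forall>x :: nat \<Rightarrow> 'a.
        (\<forall>n\<ge>1. x n \<in> C) \<longrightarrow> bounded (x ` {1..}) \<longrightarrow>
        (\<exists>p\<in>common_fixed_points C T. (\<lambda>n. phi p (x n) - phi p (T n (x n))) \<longlonglongrightarrow> 0) \<longrightarrow>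
        (\<lambda>n. phi (T n (x n)) (x n)) \<longlonglongrightarrow> 0)"

definition weakly_converges :: "(nat \<Rightarrow> 'a::real_normed_vector) \<Rightarrow> 'a \<Rightarrow> bool" where
  "weakly_converges x z \<longleftrightarrow>
     (\<forall>f :: 'a \<Rightarrow>\<^sub>L real. (\<lambda>n. blinfun_apply f (x n)) \<longlonglongrightarrow> blinfun_apply f z)"

definition weak_cluster_point :: "(nat \<Rightarrow> 'a::real_normed_vector) \<Rightarrow> 'a \<Rightarrow> bool" where
  "weak_cluster_point x z \<longleftrightarrow> (\<exists>r :: nat \<Rightarrow> nat. strict_mono r \<and> weakly_converges (x \<circ> r) z)"

definition condition_Z :: "'a::real_normed_vector set \<Rightarrow> (nat \<Rightarrow> 'a \<Rightarrow> 'a) \<Rightarrow> bool" where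
  "condition_Z C T \<longleftrightarrow>
     (\<forall>x :: nat \<Rightarrow> 'a.
        (\<forall>n\<ge>1. x n \<in> C) \<longrightarrow> bounded (x ` {1..}) \<longrightarrow>
        (\<lambda>n. T n (x n) - x n) \<longlonglongrightarrow> 0 \<longrightarrow>
        (\<forall>z. weak_cluster_point x z \<longrightarrow> z \<in> common_fixed_points C T))"

end

theory Submission imports Defs "HOL-Complex_Analysis.Great_Picard" begin

text \<open>
  Put \<open>s n = phi w (x n)\<close> and let \<open>y n\<close> be the point whose generalized projection onto \<open>C\<close> is
  \<open>x (n + 1)\<close>. Convexity of \<open>phi w\<close> in the dual variable gives
  \<open>s (n + 1) \<le> (1 - \<alpha> n) * s n + \<alpha> n * \<beta> n\<close>, where \<open>\<beta> n\<close> is twice the value of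
  \<open>duality_map u - duality_map w\<close> at \<open>y n - w\<close>. Since \<open>\<alpha>\<close>
  tends to 0 and has a divergent sum, such a recursion forces \<open>s\<close> to tend to 0 as soon
  as \<open>\<beta>\<close> has no limit point above 0 along those indices at which \<open>s\<close> does not drop by a definite
  amount (\<open>perturbed_recursion_tendsto_0\<close>).

  Suppose that along a subsequence \<open>s\<close> has asymptotically no drop. Then
  \<open>phi w (x n) - phi w (S n (x n))\<close> tends to 0 there, so strong relative nonexpansiveness makes
  \<open>phi (S n (x n)) (x n)\<close>, hence \<open>S n (x n) - x n\<close>, tend to 0. Also \<open>y n - S n (x n)\<close> tends to 0,
  because \<open>\<alpha>\<close> does and the inverse of the duality mapping is uniformly continuous on bounded sets.
  By condition (Z) a weakly convergent subsequence of \<open>x\<close> has its limit \<open>v\<close> in \<open>F\<close>, and \<open>\<beta>\<close>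
  converges along it to a number that is not positive by the variational inequality for the
  projection \<open>w\<close> of \<open>u\<close> onto \<open>F\<close> (\<open>gen_proj_variational\<close>).

  The geometry of the space enters through two elementary facts. Smoothness makes the directional
  derivatives of the norm linear functionals, which yields the duality mapping. Uniform convexity,
  in the form \<open>uniformly_convex_norm_sq\<close>, yields unique minimisers of the squared norm minus a
  linear functional on closed convex sets, therefore generalized projections, surjectivity of the
  duality mapping, and nonempty intersections of decreasing sequences of bounded closed convex
  sets. The last of these, applied to the closed convex hulls of the tails of a sequence, gives
  weak sequential compactness of bounded sets without passing through the bidual
  (\<open>bounded_imp_weakly_convergent_subsequence\<close>).
\<close>

section \<open>Smoothness and the duality mapping\<close>

lemma blinfun_le_norm: "blinfun_apply f x \<le> norm f * norm x"
  for f :: "'a::real_normed_vector \<Rightarrow>\<^sub>L real"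
  using norm_blinfun[of f x] by simp

lemma smooth_norm_differentiable:
  fixes x v :: "'a::real_normed_vector"
  assumes smooth: "smooth_space TYPE('a)" and x: "x \<noteq> 0"
  shows "\<exists>l. ((\<lambda>t. norm (x + t *\<^sub>R v)) has_real_derivative l) (at 0)"
proof (cases "v = 0")
  case True
  then show ?thesis by (intro exI[of _ 0]) simp
next
  case False
  define x' where "x' = (1 / norm x) *\<^sub>R x"
  define v' where "v' = (1 / norm v) *\<^sub>R v"
  have unit: "norm x' = 1" "norm v' = 1"
    using x False by (simp_all add: x'_def v'_def)
  then obtain l where
    "((\<lambda>t::real. (norm (x' + t *\<^sub>R v') - norm x') / t) \<longlongrightarrow> l) (at 0)"
    using smooth unfolding smooth_space_def by blast
  then have l: "((\<lambda>t. norm (x' + t *\<^sub>R v')) has_real_derivative l) (at 0)"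
    by (simp add: DERIV_def)
  have "((\<lambda>t. norm x * norm (x' + (t * (norm v / norm x)) *\<^sub>R v')) has_real_derivative
      norm x * (l * (norm v / norm x))) (at 0)"
    by (rule DERIV_cmult, rule DERIV_chain2[where f = "\<lambda>t. norm (x' + t *\<^sub>R v')"])
       (use l x in \<open>auto intro!: derivative_eq_intros\<close>)
  moreover have "norm x * norm (x' + (t * (norm v / norm x)) *\<^sub>R v') = norm (x + t *\<^sub>R v)" for t
  proof -
    have "norm x * norm (x' + (t * (norm v / norm x)) *\<^sub>R v')
        = norm (norm x *\<^sub>R (x' + (t * (norm v / norm x)) *\<^sub>R v'))" by simp
    also have "norm x *\<^sub>R (x' + (t * (norm v / norm x)) *\<^sub>R v') = x + t *\<^sub>R v"
      using x False by (simp add: x'_def v'_def scaleR_add_right)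
    finally show ?thesis .
  qed
  ultimately show ?thesis by auto
qed

text \<open>
  The directional derivative of the norm at a point \<open>x \<noteq> 0\<close> is a linear functional because it is
  at the same time sublinear and odd. Multiplied by the norm of \<open>x\<close> it is an element of the
  duality set of \<open>x\<close>, so in a smooth space no extension theorem is needed to produce one.
\<close>

lemma duality_set_nonempty:
  fixes x :: "'a::real_normed_vector"
  assumes smooth: "smooth_space TYPE('a)"
  shows "duality_set x \<noteq> {}"
proof (cases "x = 0")
  case True
  then have "0 \<in> duality_set x" by (simp add: duality_set_def)
  then show ?thesis by blast
next
  case x: False
  obtain G where G: "\<And>v. ((\<lambda>t. norm (x + t *\<^sub>R v)) has_real_derivative G v) (at 0)"
    using smooth_norm_differentiable[OF smooth x] by metis
  have lim: "((\<lambda>t. (norm (x + t *\<^sub>R v) - norm x) / t) \<longlongrightarrow> G v) (at 0)" for v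
    using G[of v] by (simp add: DERIV_def)
  have limr: "((\<lambda>t. (norm (x + t *\<^sub>R v) - norm x) / t) \<longlongrightarrow> G v) (at_right 0)" for v
    using lim[of v] filterlim_at_split by blast
  have scale: "G (c *\<^sub>R v) = c * G v" for c v
  proof -
    have "((\<lambda>t. norm (x + (t * c) *\<^sub>R v)) has_real_derivative G v * c) (at 0)"
      by (rule DERIV_chain2[where f = "\<lambda>t. norm (x + t *\<^sub>R v)"])
         (use G[of v] in \<open>auto intro!: derivative_eq_intros\<close>)
    then show ?thesis using DERIV_unique G[of "c *\<^sub>R v"] by fastforce
  qed
  have sub: "G (v + w) \<le> G v + G w" for v w
  proof -
    have "((\<lambda>t. (1/2) * ((norm (x + t *\<^sub>R (2 *\<^sub>R v)) - norm x) / t)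
          + (1/2) * ((norm (x + t *\<^sub>R (2 *\<^sub>R w)) - norm x) / t))
        \<longlongrightarrow> (1/2) * G (2 *\<^sub>R v) + (1/2) * G (2 *\<^sub>R w)) (at_right 0)"
      by (intro tendsto_intros limr)
    moreover have "\<forall>\<^sub>F t in at_right 0. (norm (x + t *\<^sub>R (v + w)) - norm x) / t \<le>
        (1/2) * ((norm (x + t *\<^sub>R (2 *\<^sub>R v)) - norm x) / t)
          + (1/2) * ((norm (x + t *\<^sub>R (2 *\<^sub>R w)) - norm x) / t)"
    proof (rule eventually_at_right_less[THEN eventually_mono])
      fix t :: real assume t: "0 < t"
      have "x + t *\<^sub>R (v + w) = (1/2) *\<^sub>R (x + t *\<^sub>R (2 *\<^sub>R v)) + (1/2) *\<^sub>R (x + t *\<^sub>R (2 *\<^sub>R w))"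
        by (simp add: scaleR_add_right flip: scaleR_add_left)
      then have "norm (x + t *\<^sub>R (v + w)) \<le>
          norm ((1/2) *\<^sub>R (x + t *\<^sub>R (2 *\<^sub>R v))) + norm ((1/2) *\<^sub>R (x + t *\<^sub>R (2 *\<^sub>R w)))"
        by (metis norm_triangle_ineq)
      then have "norm (x + t *\<^sub>R (v + w)) \<le>
          (1/2) * norm (x + t *\<^sub>R (2 *\<^sub>R v)) + (1/2) * norm (x + t *\<^sub>R (2 *\<^sub>R w))"
        by (simp only: norm_scaleR)
      then have "(norm (x + t *\<^sub>R (v + w)) - norm x) / t \<le>
          ((1/2) * norm (x + t *\<^sub>R (2 *\<^sub>R v)) + (1/2) * norm (x + t *\<^sub>R (2 *\<^sub>R w)) - norm x) / t"
        using t by (intro divide_right_mono) auto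
      then show "(norm (x + t *\<^sub>R (v + w)) - norm x) / t \<le>
        (1/2) * ((norm (x + t *\<^sub>R (2 *\<^sub>R v)) - norm x) / t)
          + (1/2) * ((norm (x + t *\<^sub>R (2 *\<^sub>R w)) - norm x) / t)"
        by (simp add: add_divide_distrib diff_divide_distrib)
    qed
    ultimately have "G (v + w) \<le> (1/2) * G (2 *\<^sub>R v) + (1/2) * G (2 *\<^sub>R w)"
      by (rule tendsto_le[OF trivial_limit_at_right_real _ limr])
    then show ?thesis by (simp add: scale)
  qed
  have add: "G (v + w) = G v + G w" for v w
  proof (rule antisym[OF sub])
    have odd: "G (- z) = - G z" for z using scale[of "-1" z] by simp
    have "G (- v + - w) \<le> G (- v) + G (- w)" by (rule sub)
    moreover have "- v + - w = - (v + w)" by simp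
    ultimately show "G v + G w \<le> G (v + w)" by (simp only: odd)
  qed
  have bound: "\<bar>G v\<bar> \<le> norm v" for v
  proof (rule tendsto_upperbound[OF tendsto_rabs[OF limr[of v]]])
    show "\<forall>\<^sub>F t in at_right 0. \<bar>(norm (x + t *\<^sub>R v) - norm x) / t\<bar> \<le> norm v"
    proof (rule eventually_at_right_less[THEN eventually_mono])
      fix t :: real assume t: "0 < t"
      have "\<bar>norm (x + t *\<^sub>R v) - norm x\<bar> \<le> norm (x + t *\<^sub>R v - x)" by (rule norm_triangle_ineq3)
      then have "\<bar>norm (x + t *\<^sub>R v) - norm x\<bar> \<le> norm v * t" using t by (simp add: mult.commute)
      then show "\<bar>(norm (x + t *\<^sub>R v) - norm x) / t\<bar> \<le> norm v"
        using t by (simp add: abs_divide pos_divide_le_eq)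
    qed
  qed simp
  have Gx: "G x = norm x"
  proof (rule tendsto_unique[OF _ limr])
    show "((\<lambda>t. (norm (x + t *\<^sub>R x) - norm x) / t) \<longlongrightarrow> norm x) (at_right 0)"
    proof (rule tendsto_eventually, rule eventually_at_right_less[THEN eventually_mono])
      fix t :: real assume t: "0 < t"
      have "norm (x + t *\<^sub>R x) = norm ((1 + t) *\<^sub>R x)" by (simp add: algebra_simps)
      also have "\<dots> = (1 + t) * norm x" using t by simp
      finally show "(norm (x + t *\<^sub>R x) - norm x) / t = norm x" using t by (simp add: field_simps)
    qed
  qed simp
  have "bounded_linear G"
    by (rule bounded_linear_intro[where K = 1]) (use add scale bound in auto)
  then have app: "blinfun_apply (norm x *\<^sub>R Blinfun G) v = norm x * G v" for v
    by (simp add: bounded_linear_Blinfun_apply scaleR_blinfun.rep_eq)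
  have "norm (norm x *\<^sub>R Blinfun G) \<le> norm x"
    by (rule norm_blinfun_bound) (use bound in \<open>auto simp: app abs_mult intro!: mult_left_mono\<close>)
  moreover have "norm x \<le> norm (norm x *\<^sub>R Blinfun G)"
    using blinfun_le_norm[of "norm x *\<^sub>R Blinfun G" x] x by (simp add: app Gx)
  ultimately have "norm (norm x *\<^sub>R Blinfun G) = norm x" by (rule antisym)
  then have "norm x *\<^sub>R Blinfun G \<in> duality_set x"
    unfolding duality_set_def by (simp only: mem_Collect_eq app Gx power2_eq_square)
  then show ?thesis by blast
qed

lemma duality_set_norm: "f \<in> duality_set x \<Longrightarrow> norm f = norm x"
  by (auto simp: duality_set_def power2_eq_iff_nonneg)

lemma duality_set_subgradient:
  assumes "f \<in> duality_set x"
  shows "(norm x)\<^sup>2 + 2 * blinfun_apply f (y - x) \<le> (norm y)\<^sup>2"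
proof -
  have "blinfun_apply f y \<le> norm x * norm y"
    using blinfun_le_norm[of f y] duality_set_norm[OF assms] by simp
  moreover have "blinfun_apply f x = (norm x)\<^sup>2" using assms by (simp add: duality_set_def)
  moreover have "2 * (norm x * norm y) \<le> (norm x)\<^sup>2 + (norm y)\<^sup>2"
    using sum_squares_bound[of "norm x" "norm y"] by (simp add: mult.assoc)
  ultimately show ?thesis unfolding blinfun.diff_right by argo
qed

lemma norm_sq_has_derivative:
  fixes x v :: "'a::real_normed_vector"
  assumes smooth: "smooth_space TYPE('a)" and f: "f \<in> duality_set x"
  shows "((\<lambda>t. (norm (x + t *\<^sub>R v))\<^sup>2) has_real_derivative 2 * blinfun_apply f v) (at 0)"
proof (cases "x = 0")
  case True
  then have "f = 0" using duality_set_norm[OF f] by simp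
  then show ?thesis using True
    by (auto simp: power_mult_distrib intro!: derivative_eq_intros)
next
  case False
  obtain l where l: "((\<lambda>t. norm (x + t *\<^sub>R v)) has_real_derivative l) (at 0)"
    using smooth_norm_differentiable[OF smooth False] by blast
  obtain D where D: "((\<lambda>t. (norm (x + t *\<^sub>R v))\<^sup>2) has_real_derivative D) (at 0)"
    using DERIV_power[OF l, of 2] by blast
  \<comment> \<open>By the subgradient inequality, subtracting the linear function of slope
    \<open>2 * blinfun_apply f v\<close> leaves a function that is minimal at 0.\<close>
  have "((\<lambda>t. (norm (x + t *\<^sub>R v))\<^sup>2 - 2 * blinfun_apply f v * t) has_real_derivative
      D - 2 * blinfun_apply f v) (at 0)"
    by (rule derivative_eq_intros D | simp)+
  then have "D - 2 * blinfun_apply f v = 0"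
  proof (rule DERIV_local_min[where d = 1])
    have "(norm x)\<^sup>2 \<le> (norm (x + t *\<^sub>R v))\<^sup>2 - 2 * blinfun_apply f v * t" for t
      using duality_set_subgradient[OF f, of "x + t *\<^sub>R v"]
      by (simp add: blinfun.scaleR_right mult.commute mult.left_commute)
    then show "\<forall>y. \<bar>0 - y\<bar> < 1 \<longrightarrow> (norm (x + 0 *\<^sub>R v))\<^sup>2 - 2 * blinfun_apply f v * 0
        \<le> (norm (x + y *\<^sub>R v))\<^sup>2 - 2 * blinfun_apply f v * y" by simp
  qed simp
  with D show ?thesis by simp
qed

lemma duality_set_eq_duality_map:
  fixes x :: "'a::real_normed_vector"
  assumes smooth: "smooth_space TYPE('a)"
  shows "duality_set x = {duality_map x}"
proof -
  obtain f where f: "f \<in> duality_set x" using duality_set_nonempty[OF smooth] by blast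
  have uniq: "g = f" if g: "g \<in> duality_set x" for g
  proof (rule blinfun_eqI)
    fix v
    show "blinfun_apply g v = blinfun_apply f v"
      using DERIV_unique[OF norm_sq_has_derivative[OF smooth f] norm_sq_has_derivative[OF smooth g]]
      by simp
  qed
  have "duality_map x = f" unfolding duality_map_def using f uniq by (rule the_equality)
  with f uniq show ?thesis by blast
qed

lemma duality_map_in_set:
  fixes x :: "'a::real_normed_vector"
  assumes "smooth_space TYPE('a)"
  shows "duality_map x \<in> duality_set x"
  using duality_set_eq_duality_map[OF assms] by simp

lemma duality_map_self:
  fixes x :: "'a::real_normed_vector"
  assumes "smooth_space TYPE('a)"
  shows "blinfun_apply (duality_map x) x = (norm x)\<^sup>2"
  using duality_map_in_set[OF assms] by (simp add: duality_set_def)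

lemma norm_duality_map:
  fixes x :: "'a::real_normed_vector"
  assumes "smooth_space TYPE('a)"
  shows "norm (duality_map x) = norm x"
  using duality_set_norm[OF duality_map_in_set[OF assms]] .


section \<open>Uniform convexity\<close>

text \<open>
  The uniform convexity of the squared norm on balls. Writing \<open>s\<close> and \<open>t\<close> for the norms
  of the two points, the mean of the squares exceeds the square of the mean by
  \<open>((s - t) / 2)\<^sup>2\<close>, which settles the case of very different norms. If the norms are close to
  each other, the points are rescaled to the unit sphere.
\<close>

lemma uniformly_convex_norm_sq:
  fixes M e :: real
  assumes uc: "uniformly_convex_space TYPE('a::real_normed_vector)" and e: "e > 0" and M: "M > 0"
  obtains d where "d > 0"
    "\<And>a b :: 'a. \<lbrakk>norm a \<le> M; norm b \<le> M; norm (a - b) \<ge> e\<rbrakk> \<Longrightarrow>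
      (norm ((1/2) *\<^sub>R (a + b)))\<^sup>2 \<le> (norm a)\<^sup>2 / 2 + (norm b)\<^sup>2 / 2 - d"
proof -
  have "3 * e / (4 * M) > 0" using e M by simp
  then obtain \<delta> where \<delta>: "\<delta> > 0" "\<And>x y :: 'a. \<lbrakk>norm x = 1; norm y = 1; norm (x - y) \<ge> 3 * e / (4 * M)\<rbrakk>
        \<Longrightarrow> norm ((1/2) *\<^sub>R (x + y)) \<le> 1 - \<delta>"
    using uc unfolding uniformly_convex_space_def by meson
  define c where "c = \<delta> * (e / 4)"
  define d where "d = min ((e/4)\<^sup>2 / 4) (c\<^sup>2)"
  have c: "c > 0" using \<delta> e by (simp add: c_def)
  have d: "d > 0" using c e by (simp add: d_def)
  have key: "(norm ((1/2) *\<^sub>R (a + b)))\<^sup>2 \<le> (norm a)\<^sup>2 / 2 + (norm b)\<^sup>2 / 2 - d"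
    if st: "norm a \<le> norm b" and b: "norm b \<le> M" and ab: "norm (a - b) \<ge> e" for a b :: 'a
  proof -
    define s t m where "s = norm a" and "t = norm b" and "m = norm ((1/2) *\<^sub>R (a + b))"
    have mean: "s\<^sup>2 / 2 + t\<^sup>2 / 2 = ((s + t) / 2)\<^sup>2 + (t - s)\<^sup>2 / 4"
      by (simp add: power2_eq_square field_simps)
    have m0: "0 \<le> m" by (simp add: m_def)
    have m: "m \<le> (s + t) / 2" using norm_triangle_ineq[of a b] by (simp add: m_def s_def t_def)
    have "m\<^sup>2 \<le> s\<^sup>2 / 2 + t\<^sup>2 / 2 - d"
    proof (cases "t - s \<ge> e / 4")
      case True
      have "(t - s)\<^sup>2 \<ge> (e/4)\<^sup>2" using True e by (intro power_mono) auto
      moreover have "m\<^sup>2 \<le> ((s + t) / 2)\<^sup>2" using m m0 by (intro power_mono) auto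
      moreover have "d \<le> (e/4)\<^sup>2 / 4" by (simp add: d_def)
      ultimately show ?thesis using mean by linarith
    next
      case False
      have "e \<le> s + t" using ab norm_triangle_ineq4[of a b] by (simp add: s_def t_def)
      then have s: "s \<ge> e / 4" using False e by linarith
      then have s0: "s > 0" using e by linarith
      have st': "s \<le> t" using st by (simp add: s_def t_def)
      then have t: "t > 0" using s0 by linarith
      define a' b' where "a' = (1/s) *\<^sub>R a" and "b' = (1/t) *\<^sub>R b"
      have unit: "norm a' = 1" "norm b' = 1"
        using s0 t by (simp_all add: a'_def b'_def s_def t_def)
      have a_eq: "a = s *\<^sub>R a'" and "b = t *\<^sub>R b'"
        using s0 t by (simp_all add: a'_def b'_def)
      then have b_eq: "b = s *\<^sub>R b' + (t - s) *\<^sub>R b'"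
        by (simp flip: scaleR_add_left)
      have "a - b = s *\<^sub>R (a' - b') - (t - s) *\<^sub>R b'"
        by (subst (1) a_eq, subst (1) b_eq) (simp add: algebra_simps)
      then have "norm (a - b) \<le> norm (s *\<^sub>R (a' - b')) + norm ((t - s) *\<^sub>R b')"
        by (metis norm_triangle_ineq4)
      then have "e \<le> s * norm (a' - b') + (t - s)"
        using ab s0 st' unit by simp
      then have "3 * e / 4 \<le> s * norm (a' - b')" using False by simp
      also have "\<dots> \<le> M * norm (a' - b')" using st' b by (intro mult_right_mono) (auto simp: t_def)
      finally have "norm (a' - b') \<ge> 3 * e / (4 * M)" using M by (simp add: field_simps)
      then have mid: "norm ((1/2) *\<^sub>R (a' + b')) \<le> 1 - \<delta>" using \<delta> unit by blast
      have "a + b = s *\<^sub>R (a' + b') + (t - s) *\<^sub>R b'"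
        using a_eq b_eq by (metis add.assoc scaleR_add_right)
      then have "(1/2) *\<^sub>R (a + b) = s *\<^sub>R ((1/2) *\<^sub>R (a' + b')) + ((t - s) / 2) *\<^sub>R b'"
        by (simp only: scaleR_add_right scaleR_scaleR mult.commute[of s]) simp
      then have "m \<le> norm (s *\<^sub>R ((1/2) *\<^sub>R (a' + b'))) + norm (((t - s) / 2) *\<^sub>R b')"
        unfolding m_def by (metis norm_triangle_ineq)
      also have "\<dots> = s * norm ((1/2) *\<^sub>R (a' + b')) + (t - s) / 2"
        using s0 st' unit by simp
      also have "\<dots> \<le> s * (1 - \<delta>) + (t - s) / 2" using mid s0 by simp
      also have "\<dots> = (s + t) / 2 - \<delta> * s" by (simp add: field_simps)
      also have "\<dots> \<le> (s + t) / 2 - c" using s \<delta> by (simp add: c_def)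
      finally have "m + c \<le> (s + t) / 2" by (simp only: le_diff_eq)
      then have "(m + c)\<^sup>2 \<le> ((s + t) / 2)\<^sup>2" using m0 c by (intro power_mono) auto
      moreover have "m\<^sup>2 + c\<^sup>2 \<le> (m + c)\<^sup>2" using m0 c by (simp add: power2_sum)
      moreover have "d \<le> c\<^sup>2" by (simp add: d_def)
      moreover have "0 \<le> (t - s)\<^sup>2 / 4" by simp
      ultimately show ?thesis using mean by linarith
    qed
    then show ?thesis by (simp add: m_def s_def t_def)
  qed
  show ?thesis
  proof (rule that[OF d])
    fix a b :: 'a assume "norm a \<le> M" "norm b \<le> M" "norm (a - b) \<ge> e"
    then show "(norm ((1/2) *\<^sub>R (a + b)))\<^sup>2 \<le> (norm a)\<^sup>2 / 2 + (norm b)\<^sup>2 / 2 - d"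
      using key[of a b] key[of b a]
      by (cases "norm a \<le> norm b") (auto simp: add.commute norm_minus_commute)
  qed
qed

lemma le_square_plus_1: "t \<le> t\<^sup>2 + 1" for t :: real
  using sum_squares_bound[of t 1] by (simp add: power2_eq_square) (smt (verit) zero_le_square)

lemma functional_coercive:
  fixes f :: "'a::real_normed_vector \<Rightarrow>\<^sub>L real"
  shows "(norm y - norm f)\<^sup>2 - (norm f)\<^sup>2 \<le> (norm y)\<^sup>2 - 2 * blinfun_apply f y"
  using blinfun_le_norm[of f y] by (simp add: power2_diff mult.commute)

text \<open>
  Depending on \<open>f\<close> and \<open>D\<close>, the minimiser is the metric projection of the origin (\<open>f = 0\<close>), a
  generalized projection (\<open>f = duality_map x\<close>), or the preimage of \<open>f\<close> under the duality mapping
  (\<open>D = UNIV\<close>). Every minimising sequence is a Cauchy sequence by uniform convexity.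
\<close>

lemma minimizer_exists:
  fixes f :: "'a::banach \<Rightarrow>\<^sub>L real" and D :: "'a set"
  assumes uc: "uniformly_convex_space TYPE('a)" and D: "D \<noteq> {}" "closed D" "convex D"
  shows "\<exists>z\<in>D. \<forall>y\<in>D. (norm z)\<^sup>2 - 2 * blinfun_apply f z \<le> (norm y)\<^sup>2 - 2 * blinfun_apply f y"
proof -
  define h where "h y = (norm y)\<^sup>2 - 2 * blinfun_apply f y" for y
  define m where "m = Inf (h ` D)"
  have coercive: "(norm y - norm f)\<^sup>2 \<le> h y + (norm f)\<^sup>2" for y
    using functional_coercive[of y f] by (simp add: h_def)
  have "bdd_below (h ` D)"
    using coercive by (intro bdd_belowI2[where m = "- (norm f)\<^sup>2"])
      (smt (verit) zero_le_power2)
  then have lower: "m \<le> h y" if "y \<in> D" for y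
    using that by (auto simp: m_def intro: cInf_lower)
  have "\<exists>y\<in>D. h y < m + 1 / real (Suc n)" for n
    using cInf_lessD[of "h ` D" "m + 1 / real (Suc n)"] D(1) by (auto simp: m_def)
  then obtain y where y: "\<And>n. y n \<in> D" "\<And>n. h (y n) < m + 1 / real (Suc n)" by metis
  define M where "M = norm f + (m + 1 + (norm f)\<^sup>2) + 1"
  have yM: "norm (y n) \<le> M" for n
  proof -
    have "1 / real (Suc n) \<le> 1" by simp
    then have "h (y n) \<le> m + 1" using y(2)[of n] by linarith
    then show ?thesis
      using coercive[of "y n"] le_square_plus_1[of "norm (y n) - norm f"] unfolding M_def by linarith
  qed
  have M1: "0 < \<bar>M\<bar> + 1" by simp
  have "Cauchy y"
  proof (rule metric_CauchyI)
    fix e :: real assume e: "e > 0"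
    obtain d where d: "d > 0" "\<And>a b :: 'a. \<lbrakk>norm a \<le> \<bar>M\<bar> + 1; norm b \<le> \<bar>M\<bar> + 1; norm (a - b) \<ge> e\<rbrakk> \<Longrightarrow>
        (norm ((1/2) *\<^sub>R (a + b)))\<^sup>2 \<le> (norm a)\<^sup>2 / 2 + (norm b)\<^sup>2 / 2 - d"
      using uniformly_convex_norm_sq[OF uc e M1] by blast
    obtain N where N: "1 / real (Suc N) < d" using d(1) by (metis nat_approx_posE)
    have "dist (y i) (y j) < e" if ij: "i \<ge> N" "j \<ge> N" for i j
    proof (rule ccontr)
      assume "\<not> dist (y i) (y j) < e"
      then have far: "norm (y i - y j) \<ge> e" by (simp add: dist_norm)
      define c where "c = (1/2) *\<^sub>R (y i + y j)"
      have "c \<in> D" using convexD[OF D(3) y(1)[of i] y(1)[of j], of "1/2" "1/2"]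
        by (simp add: c_def scaleR_add_right)
      then have "m \<le> h c" by (rule lower)
      also have "h c = (norm c)\<^sup>2 - (blinfun_apply f (y i) + blinfun_apply f (y j))"
      proof -
        have "2 * blinfun_apply f c = blinfun_apply f (y i) + blinfun_apply f (y j)"
          by (simp add: c_def blinfun.scaleR_right blinfun.add_right del: scaleR_right_distrib)
        then show ?thesis by (simp add: h_def)
      qed
      also have "(norm c)\<^sup>2 \<le> (norm (y i))\<^sup>2 / 2 + (norm (y j))\<^sup>2 / 2 - d"
        unfolding c_def by (rule d(2)[OF _ _ far]) (use yM[of i] yM[of j] in linarith)+
      also have "(norm (y i))\<^sup>2 / 2 + (norm (y j))\<^sup>2 / 2 - d - (blinfun_apply f (y i) + blinfun_apply f (y j))
          = h (y i) / 2 + h (y j) / 2 - d"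
        by (simp add: h_def field_simps)
      also have "\<dots> < m"
      proof -
        have "1 / real (Suc i) \<le> 1 / real (Suc N)" "1 / real (Suc j) \<le> 1 / real (Suc N)"
          using ij by (simp_all add: frac_le)
        then show ?thesis using y(2)[of i] y(2)[of j] N by linarith
      qed
      finally show False by simp
    qed
    then show "\<exists>N. \<forall>i\<ge>N. \<forall>j\<ge>N. dist (y i) (y j) < e" by blast
  qed
  then obtain z where z: "y \<longlonglongrightarrow> z" using Cauchy_convergent convergent_def by blast
  have zD: "z \<in> D" using closed_sequentially[OF D(2)] y(1) z by blast
  have "(\<lambda>n. h (y n)) \<longlonglongrightarrow> h z" unfolding h_def by (intro tendsto_intros z)
  moreover have "(\<lambda>n. m + 1 / real (Suc n)) \<longlonglongrightarrow> m + 0"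
    by (intro tendsto_intros LIMSEQ_Suc[OF lim_1_over_n])
  ultimately have "h z \<le> m"
    using y(2) by (metis (no_types, lifting) LIMSEQ_le add_0_right less_imp_le)
  then show ?thesis using zD lower unfolding h_def by force
qed

lemma minimizer_unique:
  fixes f :: "'a::real_normed_vector \<Rightarrow>\<^sub>L real" and D :: "'a set"
  assumes uc: "uniformly_convex_space TYPE('a)" and D: "convex D"
    and z: "z \<in> D" "\<forall>y\<in>D. (norm z)\<^sup>2 - 2 * blinfun_apply f z \<le> (norm y)\<^sup>2 - 2 * blinfun_apply f y"
    and z': "z' \<in> D" "\<forall>y\<in>D. (norm z')\<^sup>2 - 2 * blinfun_apply f z' \<le> (norm y)\<^sup>2 - 2 * blinfun_apply f y"
  shows "z = z'"
proof (rule ccontr)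
  assume "z \<noteq> z'"
  then have e: "norm (z - z') > 0" by simp
  have M: "norm z + norm z' + 1 > 0" by (smt (verit) norm_ge_zero)
  obtain d where d: "d > 0" "\<And>a b :: 'a. \<lbrakk>norm a \<le> norm z + norm z' + 1;
      norm b \<le> norm z + norm z' + 1; norm (a - b) \<ge> norm (z - z')\<rbrakk> \<Longrightarrow>
      (norm ((1/2) *\<^sub>R (a + b)))\<^sup>2 \<le> (norm a)\<^sup>2 / 2 + (norm b)\<^sup>2 / 2 - d"
    using uniformly_convex_norm_sq[OF uc e M] by blast
  define c where "c = (1/2) *\<^sub>R (z + z')"
  have c: "c \<in> D" using convexD[OF D z(1) z'(1), of "1/2" "1/2"]
    by (simp add: c_def scaleR_add_right)
  have "(norm c)\<^sup>2 \<le> (norm z)\<^sup>2 / 2 + (norm z')\<^sup>2 / 2 - d" unfolding c_def by (rule d(2)) auto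
  moreover have "2 * blinfun_apply f c = blinfun_apply f z + blinfun_apply f z'"
    by (simp add: c_def blinfun.scaleR_right blinfun.add_right del: scaleR_right_distrib)
  ultimately show False using bspec[OF z(2) c] bspec[OF z'(2) c] d(1) by linarith
qed

lemma duality_map_surj:
  assumes smooth: "smooth_space TYPE('a::banach)" and uc: "uniformly_convex_space TYPE('a)"
  shows "surj (duality_map :: 'a \<Rightarrow> _)"
  unfolding surj_def
proof
  fix f :: "'a \<Rightarrow>\<^sub>L real"
  obtain z where z: "\<And>y. (norm z)\<^sup>2 - 2 * blinfun_apply f z \<le> (norm y)\<^sup>2 - 2 * blinfun_apply f y"
    using minimizer_exists[OF uc, of UNIV f] by auto
  have min: "(norm z)\<^sup>2 - 2 * blinfun_apply f z \<le> t\<^sup>2 * (norm y)\<^sup>2 - 2 * (t * blinfun_apply f y)"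
    for t y
    using z[of "t *\<^sub>R y"] by (simp add: power_mult_distrib blinfun.scaleR_right)
  \<comment> \<open>For \<open>y \<noteq> 0\<close>, insert the minimal value of the quadratic polynomial in \<open>t\<close> on the right.\<close>
  have quad: "(blinfun_apply f y)\<^sup>2 \<le> (2 * blinfun_apply f z - (norm z)\<^sup>2) * (norm y)\<^sup>2" for y
  proof (cases "y = 0")
    case False
    define N where "N = (norm y)\<^sup>2"
    have N: "N > 0" using False by (simp add: N_def)
    have "(a / N)\<^sup>2 * N - 2 * (a / N * a) = - (a\<^sup>2 / N)" for a
      using N by (simp add: field_simps power2_eq_square)
    then have "(blinfun_apply f y)\<^sup>2 / N \<le> 2 * blinfun_apply f z - (norm z)\<^sup>2"
      using min[of "blinfun_apply f y / N" y] by (simp flip: N_def)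
    then show ?thesis using N by (simp add: pos_divide_le_eq flip: N_def)
  qed simp
  have "((norm z)\<^sup>2 - blinfun_apply f z)\<^sup>2 \<le> 0"
    using quad[of z] by (simp add: power2_eq_square algebra_simps)
  then have fz: "blinfun_apply f z = (norm z)\<^sup>2" by simp
  have "\<bar>blinfun_apply f y\<bar> \<le> norm z * norm y" for y
    using quad[of y] power2_le_iff_abs_le[of "norm z * norm y" "blinfun_apply f y"]
    by (simp add: fz power_mult_distrib)
  then have "norm f \<le> norm z" by (intro norm_blinfun_bound) auto
  moreover have "norm z \<le> norm f"
    using blinfun_le_norm[of f z] by (cases "z = 0") (simp_all add: fz power2_eq_square)
  ultimately have "f \<in> duality_set z" by (simp add: duality_set_def fz)
  then show "\<exists>z. f = duality_map z"
    using duality_set_eq_duality_map[OF smooth, of z] by blast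
qed


section \<open>Weak sequential compactness\<close>

text \<open>The points of minimal norm in the sets of the sequence converge to a common point.\<close>

lemma nested_convex_sets_meet:
  fixes K :: "nat \<Rightarrow> 'a::banach set"
  assumes uc: "uniformly_convex_space TYPE('a)"
    and K: "\<And>n. K n \<noteq> {}" "\<And>n. closed (K n)" "\<And>n. convex (K n)" "decseq K"
    and bounded: "bounded (K 0)"
  shows "\<Inter>(range K) \<noteq> {}"
proof -
  have "\<exists>z\<in>K n. \<forall>y\<in>K n. (norm z)\<^sup>2 \<le> (norm y)\<^sup>2" for n
    using minimizer_exists[OF uc K(1-3), of n 0] by simp
  then obtain z where z: "\<And>n. z n \<in> K n" "\<And>n y. y \<in> K n \<Longrightarrow> (norm (z n))\<^sup>2 \<le> (norm y)\<^sup>2"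
    by metis
  have sub: "K m \<subseteq> K n" if "n \<le> m" for m n using K(4) that by (simp add: decseq_def)
  obtain M where M: "M > 0" "\<And>y. y \<in> K 0 \<Longrightarrow> norm y \<le> M"
    using bounded by (auto simp: bounded_pos)
  have zM: "norm (z n) \<le> M" for n using M z(1) sub[of 0 n] by auto
  have mono: "(norm (z n))\<^sup>2 \<le> (norm (z m))\<^sup>2" if "n \<le> m" for m n
    using z sub[OF that] by blast
  have "convergent (\<lambda>n. (norm (z n))\<^sup>2)"
  proof (rule Bseq_monoseq_convergent)
    show "Bseq (\<lambda>n. (norm (z n))\<^sup>2)"
      using zM by (intro BseqI'[where K = "M\<^sup>2"]) (simp add: power_mono)
    show "monoseq (\<lambda>n. (norm (z n))\<^sup>2)" using mono by (auto simp: monoseq_def)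
  qed
  then have conv: "Cauchy (\<lambda>n. (norm (z n))\<^sup>2)" by (simp add: convergent_Cauchy)
  have "Cauchy z"
  proof (rule CauchyI')
    fix e :: real assume e: "e > 0"
    obtain d where d: "d > 0" "\<And>a b :: 'a. \<lbrakk>norm a \<le> M; norm b \<le> M; norm (a - b) \<ge> e\<rbrakk> \<Longrightarrow>
        (norm ((1/2) *\<^sub>R (a + b)))\<^sup>2 \<le> (norm a)\<^sup>2 / 2 + (norm b)\<^sup>2 / 2 - d"
      using uniformly_convex_norm_sq[OF uc e M(1)] by blast
    obtain N where N: "\<And>i j. \<lbrakk>i \<ge> N; j \<ge> N\<rbrakk> \<Longrightarrow> \<bar>(norm (z i))\<^sup>2 - (norm (z j))\<^sup>2\<bar> < 2 * d"
      using CauchyD[OF conv, of "2 * d"] d(1) by auto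
    have "norm (z i - z j) < e" if ij: "i \<ge> N" "j > i" for i j
    proof (rule ccontr)
      assume "\<not> norm (z i - z j) < e"
      define c where "c = (1/2) *\<^sub>R (z i + z j)"
      have far: "(norm c)\<^sup>2 \<le> (norm (z i))\<^sup>2 / 2 + (norm (z j))\<^sup>2 / 2 - d"
        unfolding c_def by (rule d(2)[OF zM zM]) (use \<open>\<not> norm (z i - z j) < e\<close> in simp)
      have "z j \<in> K i" using z(1)[of j] sub[of i j] ij by auto
      then have "c \<in> K i"
        using convexD[OF K(3)[of i] z(1)[of i], of "z j" "1/2" "1/2"] by (simp add: c_def scaleR_add_right)
      then have "(norm (z i))\<^sup>2 \<le> (norm c)\<^sup>2" by (rule z(2))
      moreover have "\<bar>(norm (z i))\<^sup>2 - (norm (z j))\<^sup>2\<bar> < 2 * d" using N ij by simp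
      ultimately show False using far by linarith
    qed
    then show "\<exists>N. \<forall>i\<ge>N. \<forall>j>i. dist (z i) (z j) < e" unfolding dist_norm by blast
  qed
  then obtain l where l: "z \<longlonglongrightarrow> l" using Cauchy_convergent convergent_def by blast
  have "l \<in> K n" for n
  proof (rule Lim_in_closed_set[OF K(2) _ _ l])
    show "\<forall>\<^sub>F m in sequentially. z m \<in> K n"
      using eventually_ge_at_top[of n] by eventually_elim (use z(1) sub in auto)
  qed simp
  then show ?thesis by blast
qed

text \<open>
  A point common to the closed convex hulls of all tails of a sequence is its only possible
  weak limit: every functional that converges along the sequence does so to its value there.
\<close>

lemma tail_hulls_common_point:
  fixes y :: "nat \<Rightarrow> 'a::banach"
  assumes uc: "uniformly_convex_space TYPE('a)" and bounded: "bounded (range y)"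
  obtains z where "z \<in> closure (span (range y))"
    "\<forall>(f :: 'a \<Rightarrow>\<^sub>L real) c. (\<lambda>n. blinfun_apply f (y n)) \<longlonglongrightarrow> c \<longrightarrow> blinfun_apply f z = c"
proof -
  define K where "K n = closure (convex hull (y ` {n..}))" for n
  have "\<Inter>(range K) \<noteq> {}"
  proof (rule nested_convex_sets_meet[OF uc])
    show "decseq K"
      unfolding K_def decseq_def by (intro allI impI closure_mono hull_mono image_mono) auto
    show "bounded (K 0)"
      using bounded unfolding K_def atLeast_0 by (intro bounded_closure bounded_convex_hull)
    show "K n \<noteq> {}" "closed (K n)" "convex (K n)" for n
      by (simp_all add: K_def convex_closure)
  qed
  then obtain z where z: "\<And>n. z \<in> K n" by blast
  have "K 0 \<subseteq> closure (span (range y))"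
    unfolding K_def by (intro closure_mono hull_minimal) (auto intro: span_base subspace_imp_convex)
  moreover have "blinfun_apply f z = c" if lim: "(\<lambda>n. blinfun_apply f (y n)) \<longlonglongrightarrow> c"
    for f :: "'a \<Rightarrow>\<^sub>L real" and c
  proof -
    have "dist (blinfun_apply f z) c \<le> e" if e: "e > 0" for e
    proof -
      obtain N where N: "\<And>n. n \<ge> N \<Longrightarrow> dist (blinfun_apply f (y n)) c < e"
        using lim e by (meson lim_sequentially)
      let ?H = "blinfun_apply f -` cball c e"
      have "y ` {N..} \<subseteq> ?H" using N by (force simp: dist_commute)
      moreover have "convex ?H"
        by (intro convex_linear_vimage bounded_linear.linear blinfun.bounded_linear_right convex_cball)
      ultimately have "convex hull (y ` {N..}) \<subseteq> ?H" by (rule hull_minimal)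
      moreover have "closed ?H"
        by (intro closed_vimage closed_cball linear_continuous_on blinfun.bounded_linear_right)
      ultimately have "K N \<subseteq> ?H" unfolding K_def by (rule closure_minimal)
      then show ?thesis using z[of N] by (auto simp: dist_commute)
    qed
    then show ?thesis by (metis dist_le_zero_iff field_le_epsilon add_0)
  qed
  ultimately show ?thesis using that z by blast
qed

text \<open>The countable dense set consists of the linear combinations with rational coefficients.\<close>

lemma span_of_sequence_separable:
  fixes x :: "nat \<Rightarrow> 'a::real_normed_vector"
  obtains D where "countable D" "span (range x) \<subseteq> closure D"
proof -
  define D where "D = range (\<lambda>l::rat list. \<Sum>i<length l. real_of_rat (l ! i) *\<^sub>R x i)"
  have "\<exists>c n. v = (\<Sum>i<n. c i *\<^sub>R x i)" if "v \<in> span (range x)" for v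
    using that
  proof (induction rule: span_induct_alt)
    case base
    show ?case by (intro exI[of _ "\<lambda>_. 0"] exI[of _ 0]) simp
  next
    case (step a b v)
    then obtain c n j where v: "v = (\<Sum>i<n. c i *\<^sub>R x i)" and b: "b = x j" by blast
    let ?N = "max n (Suc j)"
    have "(\<Sum>i<?N. (if i < n then c i else 0) *\<^sub>R x i) = (\<Sum>i<n. c i *\<^sub>R x i)"
      by (rule sum.mono_neutral_cong_right) auto
    moreover have "(\<Sum>i<?N. (if i = j then a else 0) *\<^sub>R x i) = a *\<^sub>R x j"
      by (subst sum.remove[of _ j]) auto
    ultimately have "a *\<^sub>R b + v =
        (\<Sum>i<?N. ((if i = j then a else 0) + (if i < n then c i else 0)) *\<^sub>R x i)"
      by (simp only: scaleR_add_left sum.distrib v b)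
    then show ?case
      by (intro exI[of _ "\<lambda>i. (if i = j then a else 0) + (if i < n then c i else 0)"] exI[of _ ?N])
  qed
  moreover have "(\<Sum>i<n. c i *\<^sub>R x i) \<in> closure D" for c n
    unfolding closure_approachable
  proof (intro allI impI)
    fix e :: real assume e: "e > 0"
    define B where "B = (\<Sum>i<n. norm (x i)) + 1"
    have B: "B > 0" unfolding B_def by (smt (verit) norm_ge_zero sum_nonneg)
    have "\<exists>q. \<bar>real_of_rat q - c i\<bar> < e / B" for i
    proof -
      have "e / B > 0" using e B by simp
      then obtain q where "c i < of_rat q" "of_rat q < c i + e / B"
        using of_rat_dense[of "c i" "c i + e / B"] by auto
      then show ?thesis by (intro exI[of _ q]) linarith
    qed
    then obtain q where q: "\<And>i. \<bar>real_of_rat (q i) - c i\<bar> < e / B" by metis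
    have "(\<Sum>i<n. real_of_rat (q i) *\<^sub>R x i) \<in> D"
      unfolding D_def by (rule range_eqI[of _ _ "map q [0..<n]"]) simp
    moreover have "dist (\<Sum>i<n. real_of_rat (q i) *\<^sub>R x i) (\<Sum>i<n. c i *\<^sub>R x i) < e"
    proof -
      have "dist (\<Sum>i<n. real_of_rat (q i) *\<^sub>R x i) (\<Sum>i<n. c i *\<^sub>R x i)
          = norm (\<Sum>i<n. (real_of_rat (q i) - c i) *\<^sub>R x i)"
        by (simp add: dist_norm scaleR_diff_left sum_subtractf)
      also have "\<dots> \<le> (\<Sum>i<n. (e / B) * norm (x i))"
      proof (rule sum_norm_le)
        fix i
        have "\<bar>real_of_rat (q i) - c i\<bar> * norm (x i) \<le> (e / B) * norm (x i)"
          by (rule mult_right_mono[OF less_imp_le[OF q] norm_ge_zero])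
        then show "norm ((real_of_rat (q i) - c i) *\<^sub>R x i) \<le> (e / B) * norm (x i)" by simp
      qed
      also have "\<dots> = (e / B) * (B - 1)" by (simp add: B_def sum_distrib_left)
      also have "\<dots> < e" using e B by (simp add: field_simps)
      finally show ?thesis .
    qed
    ultimately show "\<exists>y\<in>D. dist y (\<Sum>i<n. c i *\<^sub>R x i) < e" by blast
  qed
  ultimately have "span (range x) \<subseteq> closure D" by blast
  moreover have "countable D" by (simp add: D_def)
  ultimately show ?thesis using that by blast
qed

text \<open>
  The images under the duality mapping of a dense set separate points: if \<open>d\<close> is closer to \<open>v\<close>
  than half the norm of \<open>v\<close>, then \<open>duality_map d\<close> cannot vanish at \<open>v\<close>.
\<close>

lemma duality_map_separates:
  fixes v :: "'a::real_normed_vector"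
  assumes smooth: "smooth_space TYPE('a)" and v: "v \<in> closure D"
    and zero: "\<And>d. d \<in> D \<Longrightarrow> blinfun_apply (duality_map d) v = 0"
  shows "v = 0"
proof (rule ccontr)
  assume "v \<noteq> 0"
  then obtain d where d: "d \<in> D" "norm (d - v) < norm v / 2"
    using v unfolding closure_approachable dist_norm by (metis half_gt_zero zero_less_norm_iff)
  have "(norm d)\<^sup>2 = blinfun_apply (duality_map d) (d - v)"
    using zero[OF d(1)] by (simp add: blinfun.diff_right duality_map_self[OF smooth])
  also have "\<dots> \<le> norm d * norm (d - v)"
    using blinfun_le_norm[of "duality_map d"] by (simp add: norm_duality_map[OF smooth])
  finally have "norm d \<le> norm (d - v)" by (cases "d = 0") (auto simp: power2_eq_square)
  moreover have "norm v \<le> norm d + norm (d - v)" by (rule norm_triangle_sub[of v d, unfolded norm_minus_commute[of v d]])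
  ultimately show False using d(2) by linarith
qed

text \<open>
  Along a diagonal subsequence the functionals \<open>duality_map d\<close> converge, for \<open>d\<close> in a countable
  dense subset of the closed span. Since they determine the points of the closed span, the common
  points of tail hulls of all further subsequences coincide, and this point is the weak limit.
\<close>

lemma bounded_imp_weakly_convergent_subsequence:
  fixes x :: "nat \<Rightarrow> 'a::banach"
  assumes smooth: "smooth_space TYPE('a)" and uc: "uniformly_convex_space TYPE('a)"
    and bounded: "bounded (range x)"
  obtains r z where "strict_mono (r :: nat \<Rightarrow> nat)" "weakly_converges (x \<circ> r) z"
proof -
  obtain D where D: "countable D" "span (range x) \<subseteq> closure D"
    by (rule span_of_sequence_separable)
  obtain M where M: "\<And>n. norm (x n) \<le> M" using bounded by (auto simp: bounded_iff)
  \<comment> \<open>The factor makes the values bounded uniformly in \<open>d\<close>.\<close>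
  define g where "g n d = blinfun_apply (duality_map d) (x n) / (norm d + 1)" for n d
  have g: "norm (g n d) \<le> M" for n d
  proof -
    have "\<bar>blinfun_apply (duality_map d) (x n)\<bar> \<le> norm d * norm (x n)"
      using norm_blinfun[of "duality_map d" "x n"] by (simp add: norm_duality_map[OF smooth])
    also have "\<dots> \<le> (norm d + 1) * M" using M[of n] by (intro mult_mono) auto
    finally show ?thesis
      using add_nonneg_pos[OF norm_ge_zero[of d] zero_less_one]
      by (simp add: g_def pos_divide_le_eq mult.commute)
  qed
  obtain r where r: "strict_mono (r :: nat \<Rightarrow> nat)" "\<And>d. d \<in> D \<Longrightarrow> \<exists>l. (\<lambda>n. g (r n) d) \<longlonglongrightarrow> l"
    using function_convergent_subsequence[OF D(1), of g M] g by blast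
  have rD: "\<exists>l. (\<lambda>n. blinfun_apply (duality_map d) (x (r n))) \<longlonglongrightarrow> l" if d: "d \<in> D" for d
  proof -
    obtain l where "(\<lambda>n. g (r n) d) \<longlonglongrightarrow> l" using r(2)[OF d] by blast
    then have "(\<lambda>n. (norm d + 1) * g (r n) d) \<longlonglongrightarrow> (norm d + 1) * l" by (intro tendsto_intros)
    moreover have "norm d + 1 \<noteq> 0" by (smt (verit) norm_ge_zero)
    ultimately show ?thesis by (auto simp: g_def)
  qed
  have bd: "bounded (range (x \<circ> s))" for s :: "nat \<Rightarrow> nat"
    using bounded by (rule bounded_subset) auto
  have cl: "closure (span (range (x \<circ> s))) \<subseteq> closure (span (range x))" for s :: "nat \<Rightarrow> nat"
    by (intro closure_mono span_mono) auto
  obtain z where z: "z \<in> closure (span (range (x \<circ> r)))"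
    "\<forall>(f :: 'a \<Rightarrow>\<^sub>L real) c. (\<lambda>n. blinfun_apply f ((x \<circ> r) n)) \<longlonglongrightarrow> c \<longrightarrow> blinfun_apply f z = c"
    by (rule tail_hulls_common_point[OF uc bd[of r]])
  have "(\<lambda>n. blinfun_apply f ((x \<circ> r) n)) \<longlonglongrightarrow> blinfun_apply f z" for f :: "'a \<Rightarrow>\<^sub>L real"
  proof (rule ccontr)
    assume "\<not> ?thesis"
    then obtain e where e: "e > 0"
      "\<not> (\<forall>\<^sub>F n in sequentially. dist (blinfun_apply f ((x \<circ> r) n)) (blinfun_apply f z) < e)"
      unfolding tendsto_iff by blast
    obtain s :: "nat \<Rightarrow> nat" where s: "strict_mono s"
      "\<And>n. \<not> dist (blinfun_apply f ((x \<circ> r) (s n))) (blinfun_apply f z) < e"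
      using not_eventually_sequentiallyD[OF e(2)] by blast
    have "bounded (range (\<lambda>n. blinfun_apply f ((x \<circ> r \<circ> s) n)))"
      using bounded_linear_image[OF bd[of "r \<circ> s"] blinfun.bounded_linear_right[of f]]
      by (simp add: image_image comp_assoc)
    then obtain c q where q: "strict_mono (q :: nat \<Rightarrow> nat)"
      and c: "(\<lambda>n. blinfun_apply f ((x \<circ> r \<circ> s) (q n))) \<longlonglongrightarrow> c"
      using bounded_imp_convergent_subsequence unfolding o_def by blast
    obtain z' where z': "z' \<in> closure (span (range (x \<circ> (r \<circ> s \<circ> q))))"
      "\<forall>(f :: 'a \<Rightarrow>\<^sub>L real) c. (\<lambda>n. blinfun_apply f ((x \<circ> (r \<circ> s \<circ> q)) n)) \<longlonglongrightarrow> c \<longrightarrow> blinfun_apply f z' = c"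
      by (rule tail_hulls_common_point[OF uc bd])
    have "blinfun_apply (duality_map d) (z' - z) = 0" if d: "d \<in> D" for d
    proof -
      obtain l where l: "(\<lambda>n. blinfun_apply (duality_map d) (x (r n))) \<longlonglongrightarrow> l" using rD d by blast
      have "blinfun_apply (duality_map d) z = l" by (rule z(2)[rule_format]) (use l in simp)
      moreover have "blinfun_apply (duality_map d) z' = l"
        by (rule z'(2)[rule_format]) (use LIMSEQ_subseq_LIMSEQ[OF l strict_mono_o[OF s(1) q]] in \<open>simp add: o_def\<close>)
      ultimately show ?thesis by (simp add: blinfun.diff_right)
    qed
    moreover have "z' - z \<in> closure D"
    proof -
      have "z \<in> closure (span (range x))" "z' \<in> closure (span (range x))"
        using z(1) z'(1) cl by blast+
      then obtain a b where ab: "\<And>n. a n \<in> span (range x)" "a \<longlonglongrightarrow> z"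
          "\<And>n. b n \<in> span (range x)" "b \<longlonglongrightarrow> z'"
        unfolding closure_sequential by blast
      have "(\<lambda>n. b n - a n) \<longlonglongrightarrow> z' - z" by (intro tendsto_diff ab)
      then have "z' - z \<in> closure (span (range x))"
        using span_diff[OF ab(3) ab(1)]
        by (auto simp: closure_sequential intro!: exI[of _ "\<lambda>n. b n - a n"])
      then show ?thesis using closure_mono[OF D(2)] by auto
    qed
    ultimately have "z' = z" using duality_map_separates[OF smooth, of "z' - z" D] by simp
    moreover have "blinfun_apply f z' = c" by (rule z'(2)[rule_format]) (use c in \<open>simp add: o_def\<close>)
    ultimately have "(\<lambda>n. blinfun_apply f ((x \<circ> r \<circ> s) (q n))) \<longlonglongrightarrow> blinfun_apply f z" using c by simp
    then have "\<forall>\<^sub>F n in sequentially. dist (blinfun_apply f ((x \<circ> r \<circ> s) (q n))) (blinfun_apply f z) < e"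
      using e(1) by (rule tendstoD)
    then show False using s(2) by (auto simp: eventually_sequentially)
  qed
  then show ?thesis using that r(1) by (auto simp: weakly_converges_def)
qed


section \<open>The functional \<open>phi\<close> and the generalized projection\<close>

text \<open>
  The functional \<^const>\<open>phi\<close> with its second point replaced by its image in the dual: in this
  form it is a convex function of the second argument.
\<close>

definition lyapunov :: "'a::real_normed_vector \<Rightarrow> ('a \<Rightarrow>\<^sub>L real) \<Rightarrow> real" where
  "lyapunov z f = (norm z)\<^sup>2 - 2 * blinfun_apply f z + (norm f)\<^sup>2"

lemma phi_eq_lyapunov:
  fixes x y :: "'a::real_normed_vector"
  assumes "smooth_space TYPE('a)"
  shows "phi x y = lyapunov x (duality_map y)"
  by (simp add: phi_def lyapunov_def norm_duality_map[OF assms])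

lemma phi_self:
  fixes x :: "'a::real_normed_vector"
  assumes "smooth_space TYPE('a)"
  shows "phi x x = 0"
  by (simp add: phi_def duality_map_self[OF assms])

lemma phi_lower_bound:
  fixes x y :: "'a::real_normed_vector"
  assumes smooth: "smooth_space TYPE('a)"
  shows "(norm x - norm y)\<^sup>2 \<le> phi x y"
proof -
  have "blinfun_apply (duality_map y) x \<le> norm y * norm x"
    using blinfun_le_norm[of "duality_map y" x] by (simp add: norm_duality_map[OF smooth])
  then show ?thesis by (simp add: phi_def power2_diff mult.commute)
qed

lemma phi_nonneg:
  fixes x y :: "'a::real_normed_vector"
  assumes "smooth_space TYPE('a)"
  shows "0 \<le> phi x y"
  using phi_lower_bound[OF assms, of x y] by (smt (verit) zero_le_power2)

lemma norm_le_phi: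
  fixes x y :: "'a::real_normed_vector"
  assumes "smooth_space TYPE('a)"
  shows "norm y \<le> norm x + phi x y + 1"
  using le_square_plus_1[of "norm y - norm x"] phi_lower_bound[OF assms, of x y]
  by (simp add: power2_commute)

lemma phi_tendsto_left:
  assumes "a \<longlonglongrightarrow> l"
  shows "(\<lambda>n. phi (a n) y) \<longlonglongrightarrow> phi l y"
  unfolding phi_def by (intro tendsto_intros assms)

lemma lyapunov_convex:
  assumes t: "0 \<le> t" "t \<le> 1"
  shows "lyapunov z (t *\<^sub>R f + (1 - t) *\<^sub>R g) \<le> t * lyapunov z f + (1 - t) * lyapunov z g"
proof -
  have "norm (t *\<^sub>R f + (1 - t) *\<^sub>R g) \<le> t * norm f + (1 - t) * norm g"
    using norm_triangle_ineq[of "t *\<^sub>R f" "(1 - t) *\<^sub>R g"] t by simp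
  then have "(norm (t *\<^sub>R f + (1 - t) *\<^sub>R g))\<^sup>2 \<le> (t * norm f + (1 - t) * norm g)\<^sup>2"
    by (intro power_mono) auto
  also have "\<dots> = t * (norm f)\<^sup>2 + (1 - t) * (norm g)\<^sup>2 - t * (1 - t) * (norm f - norm g)\<^sup>2"
    by (simp add: power2_eq_square algebra_simps)
  also have "\<dots> \<le> t * (norm f)\<^sup>2 + (1 - t) * (norm g)\<^sup>2" using t by simp
  finally have "(norm (t *\<^sub>R f + (1 - t) *\<^sub>R g))\<^sup>2 \<le> t * (norm f)\<^sup>2 + (1 - t) * (norm g)\<^sup>2" .
  moreover have "blinfun_apply (t *\<^sub>R f + (1 - t) *\<^sub>R g) z = t * blinfun_apply f z + (1 - t) * blinfun_apply g z"
    by (simp add: blinfun.add_left blinfun.scaleR_left)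
  ultimately show ?thesis unfolding lyapunov_def by (simp add: algebra_simps)
qed

text \<open>The point \<open>y\<close> gives a subgradient of the squared dual norm at \<open>duality_map y\<close>.\<close>

lemma lyapunov_subgradient:
  fixes y z :: "'a::real_normed_vector"
  assumes smooth: "smooth_space TYPE('a)"
  shows "lyapunov z (duality_map y) + 2 * blinfun_apply g (y - z) \<le> lyapunov z (duality_map y + g)"
proof -
  define f where "f = duality_map y"
  have "blinfun_apply (f + g) y \<le> norm (f + g) * norm y" by (rule blinfun_le_norm)
  moreover have "2 * (norm (f + g) * norm y) \<le> (norm (f + g))\<^sup>2 + (norm y)\<^sup>2"
    using sum_squares_bound[of "norm (f + g)" "norm y"] by (simp add: mult.assoc)
  moreover have "blinfun_apply (f + g) y = (norm y)\<^sup>2 + blinfun_apply g y"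
    by (simp add: f_def blinfun.add_left duality_map_self[OF smooth])
  moreover have "norm f = norm y" by (simp add: f_def norm_duality_map[OF smooth])
  ultimately have "(norm f)\<^sup>2 + 2 * blinfun_apply g y \<le> (norm (f + g))\<^sup>2" by simp
  then show ?thesis
    unfolding f_def[symmetric] by (simp add: lyapunov_def blinfun.add_left blinfun.diff_right algebra_simps)
qed

lemma phi_convex_combination:
  fixes p u s y :: "'a::real_normed_vector"
  assumes smooth: "smooth_space TYPE('a)" and t: "0 \<le> t" "t \<le> 1"
    and y: "duality_map y = t *\<^sub>R duality_map u + (1 - t) *\<^sub>R duality_map s"
  shows "phi p y \<le> t * phi p u + (1 - t) * phi p s"
  using lyapunov_convex[OF t] by (simp add: phi_eq_lyapunov[OF smooth] y)

text \<open>
  Here the term with \<open>u\<close> is linearised: replacing \<open>duality_map u\<close> by \<open>duality_map p\<close> in the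
  convex combination costs at most the last summand, and \<open>phi p p = 0\<close>.
\<close>

lemma phi_convex_combination':
  fixes p u s y :: "'a::real_normed_vector"
  assumes smooth: "smooth_space TYPE('a)" and t: "0 \<le> t" "t \<le> 1"
    and y: "duality_map y = t *\<^sub>R duality_map u + (1 - t) *\<^sub>R duality_map s"
  shows "phi p y \<le> (1 - t) * phi p s + t * (2 * blinfun_apply (duality_map u - duality_map p) (y - p))"
proof -
  define g where "g = - (t *\<^sub>R (duality_map u - duality_map p))"
  have "phi p y + 2 * blinfun_apply g (y - p) \<le> lyapunov p (duality_map y + g)"
    unfolding phi_eq_lyapunov[OF smooth] by (rule lyapunov_subgradient[OF smooth])
  also have "duality_map y + g = t *\<^sub>R duality_map p + (1 - t) *\<^sub>R duality_map s"
    by (simp add: g_def y algebra_simps)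
  also have "lyapunov p \<dots> \<le> t * phi p p + (1 - t) * phi p s"
    using lyapunov_convex[OF t] by (simp add: phi_eq_lyapunov[OF smooth])
  also have "blinfun_apply g (y - p) = - (t * blinfun_apply (duality_map u - duality_map p) (y - p))"
    by (simp add: g_def blinfun.minus_left blinfun.scaleR_left)
  finally show ?thesis by (simp add: phi_self[OF smooth] algebra_simps)
qed

text \<open>
  The subgradient inequality at \<open>y\<close>, tested at the midpoint of \<open>x\<close> and \<open>y\<close>, shows that
  \<open>phi x y\<close> bounds the convexity defect of the squared norm at that midpoint.
\<close>

lemma norm_diff_less_if_phi_small:
  assumes smooth: "smooth_space TYPE('a::real_normed_vector)" and uc: "uniformly_convex_space TYPE('a)"
    and e: "e > 0" and M: "M > 0"
  obtains d where "d > 0"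
    "\<And>x y :: 'a. \<lbrakk>norm x \<le> M; norm y \<le> M; phi x y < d\<rbrakk> \<Longrightarrow> norm (x - y) < e"
proof -
  obtain d where d: "d > 0" "\<And>a b :: 'a. \<lbrakk>norm a \<le> M; norm b \<le> M; norm (a - b) \<ge> e\<rbrakk> \<Longrightarrow>
      (norm ((1/2) *\<^sub>R (a + b)))\<^sup>2 \<le> (norm a)\<^sup>2 / 2 + (norm b)\<^sup>2 / 2 - d"
    using uniformly_convex_norm_sq[OF uc e M] by blast
  show ?thesis
  proof (rule that[OF d(1)], rule ccontr)
    fix x y :: 'a
    assume xy: "norm x \<le> M" "norm y \<le> M" "phi x y < d" "\<not> norm (x - y) < e"
    define c where "c = (1/2) *\<^sub>R (x + y)"
    have "(norm c)\<^sup>2 \<le> (norm x)\<^sup>2 / 2 + (norm y)\<^sup>2 / 2 - d"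
      unfolding c_def by (rule d(2)) (use xy in auto)
    moreover have "(norm y)\<^sup>2 + 2 * blinfun_apply (duality_map y) (c - y) \<le> (norm c)\<^sup>2"
      by (rule duality_set_subgradient[OF duality_map_in_set[OF smooth]])
    moreover have "2 * blinfun_apply (duality_map y) (c - y) = blinfun_apply (duality_map y) x - (norm y)\<^sup>2"
    proof -
      have "2 *\<^sub>R (c - y) = x - y" by (simp add: c_def algebra_simps scaleR_2)
      then have "2 * blinfun_apply (duality_map y) (c - y) = blinfun_apply (duality_map y) (x - y)"
        by (metis blinfun.scaleR_right real_scaleR_def)
      then show ?thesis by (simp add: blinfun.diff_right duality_map_self[OF smooth])
    qed
    ultimately have "2 * d \<le> phi x y" unfolding phi_def by linarith
    then show False using xy(3) d(1) by linarith
  qed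
qed

lemma phi_tendsto_0_imp:
  fixes a b :: "nat \<Rightarrow> 'a::real_normed_vector"
  assumes smooth: "smooth_space TYPE('a)" and uc: "uniformly_convex_space TYPE('a)"
    and bd: "\<forall>\<^sub>F n in sequentially. norm (a n) \<le> M" "\<forall>\<^sub>F n in sequentially. norm (b n) \<le> M"
    and phi: "(\<lambda>n. phi (a n) (b n)) \<longlonglongrightarrow> 0"
  shows "(\<lambda>n. a n - b n) \<longlonglongrightarrow> 0"
proof (rule tendstoI)
  fix e :: real assume e: "e > 0"
  have M: "\<bar>M\<bar> + 1 > 0" by simp
  obtain d where d: "d > 0"
    "\<And>x y :: 'a. \<lbrakk>norm x \<le> \<bar>M\<bar> + 1; norm y \<le> \<bar>M\<bar> + 1; phi x y < d\<rbrakk> \<Longrightarrow> norm (x - y) < e"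
    using norm_diff_less_if_phi_small[OF smooth uc e M] by blast
  have "\<forall>\<^sub>F n in sequentially. phi (a n) (b n) < d" using order_tendstoD(2)[OF phi d(1)] .
  with bd show "\<forall>\<^sub>F n in sequentially. dist (a n - b n) 0 < e"
  proof eventually_elim
    case (elim n)
    then have "norm (a n - b n) < e" by (intro d(2)) linarith+
    then show ?case by simp
  qed
qed

text \<open>
  The inverse of the duality mapping is uniformly continuous on bounded sets, since
  \<open>phi a b + phi b a\<close> is the value of \<open>2 (duality_map a - duality_map b)\<close> at \<open>a - b\<close>.
\<close>

lemma duality_map_diff_tendsto_0_imp:
  fixes a b :: "nat \<Rightarrow> 'a::real_normed_vector"
  assumes smooth: "smooth_space TYPE('a)" and uc: "uniformly_convex_space TYPE('a)"
    and bd: "\<And>n. norm (a n) \<le> M" "\<And>n. norm (b n) \<le> M"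
    and lim: "(\<lambda>n. duality_map (a n) - duality_map (b n)) \<longlonglongrightarrow> 0"
  shows "(\<lambda>n. a n - b n) \<longlonglongrightarrow> 0"
proof (rule phi_tendsto_0_imp[OF smooth uc, where M = M])
  have up: "phi x y \<le> 2 * (norm (duality_map x - duality_map y) * (norm x + norm y))" for x y :: 'a
  proof -
    have "phi x y + phi y x = 2 * blinfun_apply (duality_map x - duality_map y) (x - y)"
      by (simp add: phi_def blinfun.diff_left blinfun.diff_right duality_map_self[OF smooth])
    also have "\<dots> \<le> 2 * (norm (duality_map x - duality_map y) * norm (x - y))"
      using blinfun_le_norm[of "duality_map x - duality_map y"] by simp
    also have "\<dots> \<le> 2 * (norm (duality_map x - duality_map y) * (norm x + norm y))"
      by (simp add: mult_left_mono norm_triangle_ineq4)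
    finally show ?thesis using phi_nonneg[OF smooth, of y x] by linarith
  qed
  show "(\<lambda>n. phi (a n) (b n)) \<longlonglongrightarrow> 0"
  proof (rule tendsto_sandwich[OF always_eventually always_eventually tendsto_const])
    show "\<forall>n. 0 \<le> phi (a n) (b n)" using phi_nonneg[OF smooth] by blast
    show "\<forall>n. phi (a n) (b n) \<le> 2 * (norm (duality_map (a n) - duality_map (b n)) * (M + M))"
    proof
      fix n
      have "norm (duality_map (a n) - duality_map (b n)) * (norm (a n) + norm (b n))
          \<le> norm (duality_map (a n) - duality_map (b n)) * (M + M)"
        by (intro mult_left_mono add_mono bd norm_ge_zero)
      then show "phi (a n) (b n) \<le> 2 * (norm (duality_map (a n) - duality_map (b n)) * (M + M))"
        using up[of "a n" "b n"] by linarith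
    qed
    show "(\<lambda>n. 2 * (norm (duality_map (a n) - duality_map (b n)) * (M + M))) \<longlonglongrightarrow> 0"
      using tendsto_mult_right_zero[OF tendsto_mult_left_zero[OF tendsto_norm_zero[OF lim]]] .
  qed
qed (use bd in auto)

lemma gen_proj_minimizes:
  fixes D :: "'a::banach set"
  assumes uc: "uniformly_convex_space TYPE('a)" and D: "D \<noteq> {}" "closed D" "convex D"
  shows "gen_proj D x \<in> D" "\<And>y. y \<in> D \<Longrightarrow> phi (gen_proj D x) x \<le> phi y x"
proof -
  have phi_le: "phi z x \<le> phi y x \<longleftrightarrow>
      (norm z)\<^sup>2 - 2 * blinfun_apply (duality_map x) z \<le> (norm y)\<^sup>2 - 2 * blinfun_apply (duality_map x) y"
    for y z by (simp add: phi_def)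
  have "\<exists>!z. z \<in> D \<and> (\<forall>y\<in>D. phi z x \<le> phi y x)"
    using minimizer_exists[OF uc D, of "duality_map x"] minimizer_unique[OF uc D(3)]
    unfolding phi_le by (metis (no_types, lifting))
  then have "gen_proj D x \<in> D \<and> (\<forall>y\<in>D. phi (gen_proj D x) x \<le> phi y x)"
    unfolding gen_proj_def by (rule theI')
  then show "gen_proj D x \<in> D" "\<And>y. y \<in> D \<Longrightarrow> phi (gen_proj D x) x \<le> phi y x" by blast+
qed

lemma gen_proj_variational:
  fixes D :: "'a::banach set"
  assumes smooth: "smooth_space TYPE('a)" and uc: "uniformly_convex_space TYPE('a)"
    and D: "D \<noteq> {}" "closed D" "convex D" and p: "p \<in> D"
  shows "blinfun_apply (duality_map x - duality_map (gen_proj D x)) (p - gen_proj D x) \<le> 0"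
proof -
  define z where "z = gen_proj D x"
  define v where "v = p - z"
  note min = gen_proj_minimizes[OF uc D, where x = x, folded z_def]
  have "((\<lambda>t. ((norm (z + t *\<^sub>R v))\<^sup>2 - (norm z)\<^sup>2) / t) \<longlongrightarrow> 2 * blinfun_apply (duality_map z) v) (at 0)"
    using norm_sq_has_derivative[OF smooth duality_map_in_set[OF smooth], of z v] by (simp add: DERIV_def)
  then have lim: "((\<lambda>t. ((norm (z + t *\<^sub>R v))\<^sup>2 - (norm z)\<^sup>2) / t)
      \<longlongrightarrow> 2 * blinfun_apply (duality_map z) v) (at_right 0)"
    using filterlim_at_split by blast
  have "\<forall>\<^sub>F t in at_right 0. 2 * blinfun_apply (duality_map x) v \<le> ((norm (z + t *\<^sub>R v))\<^sup>2 - (norm z)\<^sup>2) / t"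
    using eventually_at_right_real[of 0 1, OF zero_less_one]
  proof eventually_elim
    case (elim t)
    then have t: "0 < t" "t < 1" by auto
    have "z + t *\<^sub>R v = (1 - t) *\<^sub>R z + t *\<^sub>R p" by (simp add: v_def algebra_simps)
    then have "z + t *\<^sub>R v \<in> D" using convexD_alt[OF D(3) min(1) p, of t] t by simp
    then have "phi z x \<le> phi (z + t *\<^sub>R v) x" by (rule min(2))
    then have "2 * blinfun_apply (duality_map x) v * t \<le> (norm (z + t *\<^sub>R v))\<^sup>2 - (norm z)\<^sup>2"
      by (simp add: phi_def blinfun.add_right blinfun.scaleR_right mult.commute)
    then show ?case using t by (simp add: pos_le_divide_eq)
  qed
  then have "2 * blinfun_apply (duality_map x) v \<le> 2 * blinfun_apply (duality_map z) v"
    by (intro tendsto_lowerbound[OF lim]) auto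
  then show ?thesis by (simp add: blinfun.diff_left flip: z_def v_def)
qed

lemma phi_gen_proj_le:
  fixes D :: "'a::banach set"
  assumes smooth: "smooth_space TYPE('a)" and uc: "uniformly_convex_space TYPE('a)"
    and D: "D \<noteq> {}" "closed D" "convex D" and p: "p \<in> D"
  shows "phi p (gen_proj D x) \<le> phi p x"
proof -
  define z where "z = gen_proj D x"
  have "phi p x - phi p z - phi z x = - (2 * blinfun_apply (duality_map x - duality_map z) (p - z))"
    by (simp add: phi_def blinfun.diff_left blinfun.diff_right duality_map_self[OF smooth] power2_eq_square)
  moreover have "blinfun_apply (duality_map x - duality_map z) (p - z) \<le> 0"
    unfolding z_def by (rule gen_proj_variational[OF smooth uc D p])
  moreover have "0 \<le> phi z x" by (rule phi_nonneg[OF smooth])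
  ultimately show ?thesis unfolding z_def[symmetric] by linarith
qed


section \<open>Fixed points of mappings of type (r)\<close>

lemma phi_le_0_imp_eq:
  fixes x y :: "'a::real_normed_vector"
  assumes smooth: "smooth_space TYPE('a)" and uc: "uniformly_convex_space TYPE('a)" and "phi x y \<le> 0"
  shows "x = y"
proof (rule ccontr)
  assume "x \<noteq> y"
  then have e: "norm (x - y) > 0" by simp
  have M: "norm x + norm y + 1 > 0" by (smt (verit) norm_ge_zero)
  obtain d where d: "d > 0" "\<And>a b :: 'a. \<lbrakk>norm a \<le> norm x + norm y + 1; norm b \<le> norm x + norm y + 1;
      phi a b < d\<rbrakk> \<Longrightarrow> norm (a - b) < norm (x - y)"
    using norm_diff_less_if_phi_small[OF smooth uc e M] by blast
  have "norm (x - y) < norm (x - y)" by (rule d(2)) (use assms(3) d(1) in auto)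
  then show False by simp
qed

lemma type_r_fixed_points_closed:
  fixes C :: "'a::real_normed_vector set"
  assumes smooth: "smooth_space TYPE('a)" and uc: "uniformly_convex_space TYPE('a)"
    and C: "closed C" and T: "type_r C T"
  shows "closed (fixed_points C T)"
proof (rule closed_sequential_limits[THEN iffD2], intro allI impI, elim conjE)
  fix p l assume p: "\<forall>n. p n \<in> fixed_points C T" and lim: "p \<longlonglongrightarrow> l"
  have lC: "l \<in> C"
    using closed_sequentially[OF C _ lim] p by (simp add: fixed_points_def)
  have "phi l (T l) \<le> phi l l"
    by (rule LIMSEQ_le[OF phi_tendsto_left[OF lim] phi_tendsto_left[OF lim]])
       (use T p lC in \<open>auto simp: type_r_def\<close>)
  then have "l = T l" by (intro phi_le_0_imp_eq[OF smooth uc]) (simp add: phi_self[OF smooth])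
  then show "l \<in> fixed_points C T" using lC by (simp add: fixed_points_def)
qed

lemma type_r_fixed_points_convex:
  fixes C :: "'a::real_normed_vector set"
  assumes smooth: "smooth_space TYPE('a)" and uc: "uniformly_convex_space TYPE('a)"
    and C: "convex C" and T: "type_r C T"
  shows "convex (fixed_points C T)"
proof (rule convexI)
  fix a b :: 'a and s t :: real
  assume ab: "a \<in> fixed_points C T" "b \<in> fixed_points C T" and st: "0 \<le> s" "0 \<le> t" "s + t = 1"
  define p where "p = s *\<^sub>R a + t *\<^sub>R b"
  have pC: "p \<in> C"
    using convexD[OF C, of a b s t] ab st by (simp add: p_def fixed_points_def)
  \<comment> \<open>The left-hand side minus \<open>phi p y\<close> does not depend on \<open>y\<close>, so the inequalities for \<open>a\<close> and
    \<open>b\<close> carry over to \<open>p\<close>.\<close>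
  have split: "s * phi a y + t * phi b y = phi p y + (s * (norm a)\<^sup>2 + t * (norm b)\<^sup>2 - (norm p)\<^sup>2)" for y
  proof -
    have "s * (norm y)\<^sup>2 + t * (norm y)\<^sup>2 = (norm y)\<^sup>2" using st by (simp flip: distrib_right)
    moreover have "blinfun_apply (duality_map y) p
        = s * blinfun_apply (duality_map y) a + t * blinfun_apply (duality_map y) b"
      by (simp add: p_def blinfun.add_right blinfun.scaleR_right)
    ultimately show ?thesis by (simp add: phi_def algebra_simps)
  qed
  have "s * phi a (T p) + t * phi b (T p) \<le> s * phi a p + t * phi b p"
    using T ab pC st by (intro add_mono mult_left_mono) (auto simp: type_r_def)
  then have "phi p (T p) \<le> phi p p" unfolding split by simp
  then have "p = T p" by (intro phi_le_0_imp_eq[OF smooth uc]) (simp add: phi_self[OF smooth])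
  then show "s *\<^sub>R a + t *\<^sub>R b \<in> fixed_points C T" using pC by (simp add: fixed_points_def flip: p_def)
qed


section \<open>Recursive inequalities and limits of real sequences\<close>

lemma contraction_recursion_tendsto_0:
  fixes t \<alpha> :: "nat \<Rightarrow> real"
  assumes nonneg: "\<And>n. 0 \<le> t n" and N: "N \<ge> 1"
    and rec: "\<And>n. n \<ge> N \<Longrightarrow> t (Suc n) \<le> (1 - \<alpha> n) * t n"
    and sum: "filterlim (\<lambda>N. \<Sum>n=1..N. \<alpha> n) at_top sequentially"
  shows "t \<longlonglongrightarrow> 0"
proof -
  define A where "A n = (\<Sum>i=1..n. \<alpha> i)" for n
  obtain K where K: "N = Suc K" using N by (cases N) auto
  have bound: "t (Suc n) \<le> t N * exp (A K - A n)" if "n \<ge> K" for n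
    using that
  proof (induction n rule: dec_induct)
    case base
    show ?case by (simp add: K)
  next
    case (step n)
    have "t (Suc (Suc n)) \<le> (1 - \<alpha> (Suc n)) * t (Suc n)" using rec[of "Suc n"] step.hyps K by simp
    also have "\<dots> \<le> exp (- \<alpha> (Suc n)) * t (Suc n)"
      using exp_ge_add_one_self[of "- \<alpha> (Suc n)"] nonneg[of "Suc n"] by (intro mult_right_mono) auto
    also have "\<dots> \<le> exp (- \<alpha> (Suc n)) * (t N * exp (A K - A n))"
      using step.IH by (intro mult_left_mono) auto
    also have "\<dots> = t N * exp (A K - A (Suc n))"
    proof -
      have "A K - A (Suc n) = - \<alpha> (Suc n) + (A K - A n)" by (simp add: A_def)
      then show ?thesis by (simp only: exp_add mult_ac)
    qed
    finally show ?case .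
  qed
  have "filterlim (\<lambda>n. A n - A K) at_top sequentially"
    using filterlim_tendsto_add_at_top[OF tendsto_const[of "- A K"] sum]
    by (simp add: A_def)
  then have "filterlim (\<lambda>n. - (A n - A K)) at_bot sequentially"
    by (simp add: filterlim_uminus_at_bot_at_top filterlim_uminus_at_top)
  then have "(\<lambda>n. exp (A K - A n)) \<longlonglongrightarrow> 0"
    using filterlim_compose[OF exp_at_bot] by fastforce
  then have "(\<lambda>n. t N * exp (A K - A n)) \<longlonglongrightarrow> 0" by (rule tendsto_mult_right_zero)
  then have "(\<lambda>n. t (Suc n)) \<longlonglongrightarrow> 0"
  proof (rule tendsto_sandwich[OF _ _ tendsto_const, rotated 2])
    show "\<forall>\<^sub>F n in sequentially. t (Suc n) \<le> t N * exp (A K - A n)"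
      using eventually_ge_at_top[of K] by eventually_elim (rule bound)
  qed (simp add: nonneg)
  then show ?thesis by (rule LIMSEQ_imp_Suc)
qed

text \<open>
  The bound on the perturbation \<open>\<beta>\<close> is only required at indices where \<open>s\<close> does not drop by
  a definite amount. Where it drops by \<open>\<delta>\<close>, the contraction inequality holds for the positive
  part of \<open>s - \<epsilon>\<close> anyway, because \<open>\<alpha> n * s n\<close> is eventually below \<open>\<delta>\<close>.
\<close>

lemma perturbed_recursion_tendsto_0:
  fixes s \<alpha> \<beta> :: "nat \<Rightarrow> real"
  assumes nonneg: "\<And>n. 0 \<le> s n" and bounded: "\<And>n. n \<ge> 1 \<Longrightarrow> s n \<le> M"
    and alpha: "\<And>n. n \<ge> 1 \<Longrightarrow> 0 \<le> \<alpha> n \<and> \<alpha> n \<le> 1" "\<alpha> \<longlonglongrightarrow> 0"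
    and sum: "filterlim (\<lambda>N. \<Sum>n=1..N. \<alpha> n) at_top sequentially"
    and rec: "\<And>n. n \<ge> 1 \<Longrightarrow> s (Suc n) \<le> (1 - \<alpha> n) * s n + \<alpha> n * \<beta> n"
    and beta: "\<And>\<epsilon>. \<epsilon> > 0 \<Longrightarrow> \<exists>\<delta>>0. \<forall>\<^sub>F n in sequentially. s n - \<delta> \<le> s (Suc n) \<longrightarrow> \<beta> n \<le> \<epsilon>"
  shows "s \<longlonglongrightarrow> 0"
proof (rule tendstoI)
  fix e :: real assume e: "e > 0"
  define \<epsilon> where "\<epsilon> = e / 2"
  have \<epsilon>: "\<epsilon> > 0" using e by (simp add: \<epsilon>_def)
  define t where "t n = max (s n - \<epsilon>) 0" for n
  obtain \<delta> where \<delta>: "\<delta> > 0" "\<forall>\<^sub>F n in sequentially. s n - \<delta> \<le> s (Suc n) \<longrightarrow> \<beta> n \<le> \<epsilon>"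
    using beta[OF \<epsilon>] by blast
  have "(\<lambda>n. \<alpha> n * M) \<longlonglongrightarrow> 0" using tendsto_mult_left_zero[OF alpha(2)] .
  then have "\<forall>\<^sub>F n in sequentially. \<alpha> n * M < \<delta>" using \<delta>(1) by (rule order_tendstoD)
  with \<delta>(2) have "\<forall>\<^sub>F n in sequentially. t (Suc n) \<le> (1 - \<alpha> n) * t n"
    using eventually_ge_at_top[of 1]
  proof eventually_elim
    case (elim n)
    have a: "0 \<le> \<alpha> n" "\<alpha> n \<le> 1" using alpha(1) elim by auto
    have t0: "0 \<le> (1 - \<alpha> n) * t n" using a by (simp add: t_def)
    have "s (Suc n) - \<epsilon> \<le> (1 - \<alpha> n) * (s n - \<epsilon>)"
    proof (cases "s n - \<delta> \<le> s (Suc n)")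
      case True
      then have "\<alpha> n * \<beta> n \<le> \<alpha> n * \<epsilon>" using elim a by (intro mult_left_mono) auto
      then show ?thesis using rec[of n] elim by (simp add: algebra_simps)
    next
      case False
      have "\<alpha> n * (s n - \<epsilon>) \<le> \<alpha> n * M" using bounded[of n] elim a \<epsilon> by (intro mult_left_mono) auto
      then have "\<alpha> n * (s n - \<epsilon>) \<le> \<delta>" using elim by linarith
      then show ?thesis using False by (simp add: algebra_simps)
    qed
    also have "\<dots> \<le> (1 - \<alpha> n) * t n" using a by (intro mult_left_mono) (auto simp: t_def)
    finally show ?case using t0 by (simp add: t_def)
  qed
  then obtain N where N: "\<And>n. n \<ge> N \<Longrightarrow> t (Suc n) \<le> (1 - \<alpha> n) * t n"
    by (auto simp: eventually_sequentially)
  have "t \<longlonglongrightarrow> 0"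
    by (rule contraction_recursion_tendsto_0[of t "Suc N", OF _ _ _ sum]) (use N in \<open>auto simp: t_def\<close>)
  then have "\<forall>\<^sub>F n in sequentially. t n < \<epsilon>" using \<epsilon> by (rule order_tendstoD)
  then show "\<forall>\<^sub>F n in sequentially. dist (s n) 0 < e"
  proof eventually_elim
    case (elim n)
    then have "s n < e" unfolding t_def \<epsilon>_def by linarith
    then show ?case using nonneg[of n] by simp
  qed
qed

lemma tendsto_0_if_zero_off_subsequence:
  fixes f :: "nat \<Rightarrow> real"
  assumes r: "strict_mono r" and lim: "(\<lambda>k. f (r k)) \<longlonglongrightarrow> 0"
    and zero: "\<And>n. n \<ge> 1 \<Longrightarrow> n \<notin> range r \<Longrightarrow> f n = 0"
  shows "f \<longlonglongrightarrow> 0"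
proof (rule tendstoI)
  fix e :: real assume e: "e > 0"
  obtain K where K: "\<And>k. k \<ge> K \<Longrightarrow> dist (f (r k)) 0 < e"
    using lim e by (meson lim_sequentially)
  have "dist (f n) 0 < e" if n: "n \<ge> max 1 (r K)" for n
  proof (cases "n \<in> range r")
    case True
    then obtain k where k: "n = r k" by blast
    then have "K \<le> k" using n strict_mono_less_eq[OF r, of K k] by simp
    then show ?thesis using K k by blast
  next
    case False
    then show ?thesis using zero[of n] n e by simp
  qed
  then show "\<forall>\<^sub>F n in sequentially. dist (f n) 0 < e" unfolding eventually_sequentially by blast
qed


section \<open>Strong convergence\<close>

lemma common_fixed_points_closed_convex:
  fixes C :: "'a::real_normed_vector set"
  assumes smooth: "smooth_space TYPE('a)" and uc: "uniformly_convex_space TYPE('a)"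
    and C: "closed C" "convex C" and T: "\<And>n. n \<ge> 1 \<Longrightarrow> type_r C (T n)"
  shows "closed (common_fixed_points C T)" "convex (common_fixed_points C T)"
  unfolding common_fixed_points_def
  using type_r_fixed_points_closed[OF smooth uc C(1) T] type_r_fixed_points_convex[OF smooth uc C(2) T]
  by (auto intro!: closed_INT convex_INT)

theorem theorem4p1:
  fixes C F :: "'a::banach set"
    and S :: "nat \<Rightarrow> 'a \<Rightarrow> 'a"
    and \<alpha> :: "nat \<Rightarrow> real"
    and u w :: 'a
    and x :: "nat \<Rightarrow> 'a"
  assumes smooth: "smooth_space TYPE('a)"
    and uniformly_convex: "uniformly_convex_space TYPE('a)"
    and C: "C \<noteq> {}" "closed C" "convex C"
    and F_def: "F = common_fixed_points C S"
    and F_nonempty: "F \<noteq> {}"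
    and alpha_range: "\<forall>n\<ge>1. 0 \<le> \<alpha> n \<and> \<alpha> n \<le> 1"
    and alpha_lim: "\<alpha> \<longlonglongrightarrow> 0"
    and x_1: "x 1 \<in> C"
    and x_step: "\<forall>n\<ge>1. x (n + 1) =
      gen_proj C (inv duality_map
        (\<alpha> n *\<^sub>R duality_map u + (1 - \<alpha> n) *\<^sub>R duality_map (S n (x n))))"
    and i: "strongly_relatively_nonexpansive_seq C S"
    and ii: "condition_Z C S"
    and iii: "\<forall>n\<ge>1. \<alpha> n > 0" "filterlim (\<lambda>N. \<Sum>n=1..N. \<alpha> n) at_top sequentially"
    and w_def: "w = gen_proj F u"
  shows "x \<longlonglongrightarrow> w"
proof -
  note uc = uniformly_convex
  define y where "y n = inv duality_map
    (\<alpha> n *\<^sub>R duality_map u + (1 - \<alpha> n) *\<^sub>R duality_map (S n (x n)))" for n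
  have Jy: "duality_map (y n) = \<alpha> n *\<^sub>R duality_map u + (1 - \<alpha> n) *\<^sub>R duality_map (S n (x n))" for n
    unfolding y_def by (rule surj_f_inv_f[OF duality_map_surj[OF smooth uc]])
  have x_Suc: "x (Suc n) = gen_proj C (y n)" if "n \<ge> 1" for n
    using x_step that by (simp add: y_def)
  have xC: "x n \<in> C" if "n \<ge> 1" for n
    using that
  proof (induction n rule: dec_induct)
    case base
    show ?case using x_1 by simp
  next
    case (step n)
    then show ?case using x_Suc gen_proj_minimizes(1)[OF uc C] by simp
  qed
  have alpha: "0 \<le> \<alpha> n" "\<alpha> n \<le> 1" if "n \<ge> 1" for n using alpha_range that by auto

  have type_r: "type_r C (S n)" if "n \<ge> 1" for n
    using i that by (simp add: strongly_relatively_nonexpansive_seq_def)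
  have F: "F \<noteq> {}" "closed F" "convex F"
    unfolding F_def using F_nonempty common_fixed_points_closed_convex[OF smooth uc C(2,3) type_r]
    by (auto simp: F_def)
  have w: "w \<in> F" unfolding w_def by (rule gen_proj_minimizes(1)[OF uc F])
  have w_fixed: "w \<in> fixed_points C (S n)" if "n \<ge> 1" for n
    using w that by (auto simp: F_def common_fixed_points_def)
  then have wC: "w \<in> C" by (auto simp: fixed_points_def)
  have Sw: "S n w = w" if "n \<ge> 1" for n using w_fixed[OF that] by (simp add: fixed_points_def)
  have phi_S: "phi w (S n v) \<le> phi w v" if "n \<ge> 1" "v \<in> C" for n v
    using type_r[OF that(1)] w_fixed[OF that(1)] that(2) by (auto simp: type_r_def)

  have phi_y: "phi w (y n) \<le> \<alpha> n * phi w u + (1 - \<alpha> n) * phi w (S n (x n))" if "n \<ge> 1" for n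
    by (rule phi_convex_combination[OF smooth alpha[OF that] Jy])
  have phi_Suc: "phi w (x (Suc n)) \<le> phi w (y n)" if "n \<ge> 1" for n
    unfolding x_Suc[OF that] by (rule phi_gen_proj_le[OF smooth uc C wC])
  define M where "M = max (phi w u) (phi w (x 1))"
  have combination_le: "\<alpha> n * phi w u + (1 - \<alpha> n) * phi w (S n (x n)) \<le> M"
    if n: "n \<ge> 1" and "phi w (x n) \<le> M" for n
  proof -
    have "phi w (S n (x n)) \<le> M" using phi_S[OF n xC[OF n]] that by linarith
    then have "\<alpha> n * phi w u + (1 - \<alpha> n) * phi w (S n (x n)) \<le> \<alpha> n * M + (1 - \<alpha> n) * M"
      using alpha[OF n] by (intro add_mono mult_left_mono) (auto simp: M_def)
    then show ?thesis by (simp add: algebra_simps)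
  qed
  have phi_x: "phi w (x n) \<le> M" if "n \<ge> 1" for n
    using that
  proof (induction n rule: dec_induct)
    case base
    show ?case by (simp add: M_def)
  next
    case (step n)
    then show ?case using phi_Suc[of n] phi_y[of n] combination_le[of n] by simp
  qed
  define B where "B = norm w + M + 1"
  have le_B: "norm v \<le> B" if "phi w v \<le> M" for v
    using norm_le_phi[OF smooth, where x = w and y = v] that by (simp add: B_def)
  have x_B: "norm (x n) \<le> B" if "n \<ge> 1" for n using le_B phi_x[OF that] .
  have Sx_B: "norm (S n (x n)) \<le> B" if "n \<ge> 1" for n
    using le_B phi_S[OF that xC[OF that]] phi_x[OF that] by simp
  have y_B: "norm (y n) \<le> B" if "n \<ge> 1" for n
    using le_B phi_y[OF that] combination_le[OF that phi_x[OF that]] by simp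
  have w_B: "norm w \<le> B" using x_B[of 1] phi_x[of 1] phi_nonneg[OF smooth, of w "x 1"] by (simp add: B_def)

  define g where "g = duality_map u - duality_map w"
  define s where "s n = phi w (x n)" for n
  define \<beta> where "\<beta> n = 2 * blinfun_apply g (y n - w)" for n

  have "s \<longlonglongrightarrow> 0"
  proof (rule perturbed_recursion_tendsto_0[where M = M and \<alpha> = \<alpha> and \<beta> = \<beta>])
    show "0 \<le> s n" for n by (simp add: s_def phi_nonneg[OF smooth])
    show "s n \<le> M" if "n \<ge> 1" for n using phi_x[OF that] by (simp add: s_def)
    show "0 \<le> \<alpha> n \<and> \<alpha> n \<le> 1" if "n \<ge> 1" for n using alpha_range that by blast
    show "s (Suc n) \<le> (1 - \<alpha> n) * s n + \<alpha> n * \<beta> n" if n: "n \<ge> 1" for n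
    proof -
      have "s (Suc n) \<le> phi w (y n)" using phi_Suc[OF n] by (simp add: s_def)
      also have "\<dots> \<le> (1 - \<alpha> n) * phi w (S n (x n)) + \<alpha> n * \<beta> n"
        unfolding \<beta>_def g_def by (rule phi_convex_combination'[OF smooth alpha[OF n] Jy])
      also have "(1 - \<alpha> n) * phi w (S n (x n)) \<le> (1 - \<alpha> n) * s n"
        unfolding s_def using phi_S[OF n xC[OF n]] alpha[OF n] by (intro mult_left_mono) auto
      finally show ?thesis by simp
    qed
  next
    fix \<epsilon> :: real assume \<epsilon>: "\<epsilon> > 0"
    show "\<exists>\<delta>>0. \<forall>\<^sub>F n in sequentially. s n - \<delta> \<le> s (Suc n) \<longrightarrow> \<beta> n \<le> \<epsilon>"
    proof (rule ccontr)
      assume neg: "\<not> ?thesis"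
      \<comment> \<open>Extract a subsequence \<open>r\<close> along which \<open>s\<close> drops by at most \<open>1 / (k + 1)\<close> at the
        \<open>k\<close>-th term although \<open>\<beta>\<close> exceeds \<open>\<epsilon>\<close>.\<close>
      have ex: "\<exists>n>m. n \<ge> 1 \<and> s n - 1 / real (Suc k) \<le> s (Suc n) \<and> \<beta> n > \<epsilon>" for k m
      proof -
        have "\<not> (\<forall>\<^sub>F n in sequentially. s n - 1 / real (Suc k) \<le> s (Suc n) \<longrightarrow> \<beta> n \<le> \<epsilon>)"
          using neg by (meson of_nat_0_less_iff zero_less_Suc zero_less_divide_1_iff)
        then obtain n where "n \<ge> Suc m" "s n - 1 / real (Suc k) \<le> s (Suc n)" "\<not> \<beta> n \<le> \<epsilon>"
          unfolding eventually_sequentially by blast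
        then show ?thesis by (intro exI[of _ n]) auto
      qed
      have "\<exists>r. \<forall>k. (r k \<ge> 1 \<and> s (r k) - 1 / real (Suc k) \<le> s (Suc (r k)) \<and> \<beta> (r k) > \<epsilon>) \<and> r k < r (Suc k)"
        by (rule dependent_nat_choice) (use ex in blast)+
      then obtain r :: "nat \<Rightarrow> nat" where r1: "\<And>k. r k \<ge> 1"
        and drop: "\<And>k. s (r k) - 1 / real (Suc k) \<le> s (Suc (r k))"
        and large: "\<And>k. \<beta> (r k) > \<epsilon>" and "\<And>k. r k < r (Suc k)" by blast
      then have r: "strict_mono r" by (simp add: strict_mono_Suc_iff)
      have alpha_r: "(\<lambda>k. \<alpha> (r k)) \<longlonglongrightarrow> 0"
        using LIMSEQ_subseq_LIMSEQ[OF alpha_lim r] by (simp add: o_def)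

      \<comment> \<open>The conditions on \<open>S\<close> concern full sequences; off the subsequence, \<open>x\<close> is replaced
        by the common fixed point \<open>w\<close>.\<close>
      define z where "z n = (if n \<in> range r then x n else w)" for n
      have z_r: "z (r k) = x (r k)" for k by (simp add: z_def)
      have zC: "\<forall>n\<ge>1. z n \<in> C" using xC wC by (simp add: z_def)
      have z_B: "norm (z n) \<le> B" "norm (S n (z n)) \<le> B" if "n \<ge> 1" for n
        using x_B[OF that] Sx_B[OF that] w_B Sw[OF that] by (auto simp: z_def)
      have z_bounded: "bounded (z ` {1..})" using z_B(1) by (auto simp: bounded_iff)
      have "(\<lambda>n. phi w (z n) - phi w (S n (z n))) \<longlonglongrightarrow> 0"
      proof (rule tendsto_0_if_zero_off_subsequence[OF r])
        show "phi w (z n) - phi w (S n (z n)) = 0" if "n \<ge> 1" "n \<notin> range r" for n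
          using that by (simp add: z_def Sw)
        show "(\<lambda>k. phi w (z (r k)) - phi w (S (r k) (z (r k)))) \<longlonglongrightarrow> 0"
        proof (rule tendsto_sandwich[OF always_eventually always_eventually tendsto_const])
          show "\<forall>k. 0 \<le> phi w (z (r k)) - phi w (S (r k) (z (r k)))"
            using phi_S[OF r1 xC[OF r1]] by (simp add: z_r)
          show "\<forall>k. phi w (z (r k)) - phi w (S (r k) (z (r k))) \<le> \<alpha> (r k) * phi w u + 1 / real (Suc k)"
          proof
            fix k
            have "s (Suc (r k)) \<le> \<alpha> (r k) * phi w u + (1 - \<alpha> (r k)) * phi w (S (r k) (x (r k)))"
              using phi_Suc[OF r1] phi_y[OF r1] order_trans unfolding s_def by blast
            also have "(1 - \<alpha> (r k)) * phi w (S (r k) (x (r k))) \<le> 1 * phi w (S (r k) (x (r k)))"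
              using alpha[OF r1] phi_nonneg[OF smooth] by (intro mult_right_mono) auto
            finally show "phi w (z (r k)) - phi w (S (r k) (z (r k))) \<le> \<alpha> (r k) * phi w u + 1 / real (Suc k)"
              using drop[of k] by (simp add: z_r s_def)
          qed
          show "(\<lambda>k. \<alpha> (r k) * phi w u + 1 / real (Suc k)) \<longlonglongrightarrow> 0"
            using tendsto_add[OF tendsto_mult_left_zero[OF alpha_r] LIMSEQ_Suc[OF lim_1_over_n]] by simp
        qed
      qed
      then have "(\<lambda>n. phi (S n (z n)) (z n)) \<longlonglongrightarrow> 0"
        using i zC z_bounded w unfolding strongly_relatively_nonexpansive_seq_def F_def by blast
      then have Sz: "(\<lambda>n. S n (z n) - z n) \<longlonglongrightarrow> 0"
        by (rule phi_tendsto_0_imp[OF smooth uc, where M = B, rotated 2])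
           (use z_B in \<open>auto simp: eventually_sequentially intro!: exI[of _ 1]\<close>)
      then have cluster: "v \<in> F" if "weak_cluster_point z v" for v
        using ii zC z_bounded that unfolding condition_Z_def F_def by blast

      have "bounded (range (x \<circ> r))" using x_B[OF r1] by (auto simp: bounded_iff)
      then obtain q v where q: "strict_mono q" and v: "weakly_converges ((x \<circ> r) \<circ> q) v"
        using bounded_imp_weakly_convergent_subsequence[OF smooth uc] by blast
      have "z \<circ> (r \<circ> q) = (x \<circ> r) \<circ> q" by (simp add: fun_eq_iff z_r)
      then have "weak_cluster_point z v"
        unfolding weak_cluster_point_def using v strict_mono_o[OF r q] by metis
      then have vF: "v \<in> F" by (rule cluster)

      have "(\<lambda>k. y (r k) - S (r k) (x (r k))) \<longlonglongrightarrow> 0"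
      proof (rule duality_map_diff_tendsto_0_imp[OF smooth uc, where M = B])
        show "norm (y (r k)) \<le> B" for k by (rule y_B[OF r1])
        show "norm (S (r k) (x (r k))) \<le> B" for k by (rule Sx_B[OF r1])
        show "(\<lambda>k. duality_map (y (r k)) - duality_map (S (r k) (x (r k)))) \<longlonglongrightarrow> 0"
        proof (rule Lim_null_comparison)
          have "norm (duality_map (y (r k)) - duality_map (S (r k) (x (r k)))) \<le> \<alpha> (r k) * (norm u + B)" for k
          proof -
            have "duality_map (y (r k)) - duality_map (S (r k) (x (r k)))
                = \<alpha> (r k) *\<^sub>R (duality_map u - duality_map (S (r k) (x (r k))))"
              by (simp add: Jy algebra_simps)
            moreover have "norm (duality_map u - duality_map (S (r k) (x (r k)))) \<le> norm u + B"
              using norm_triangle_ineq4[of "duality_map u" "duality_map (S (r k) (x (r k)))"] Sx_B[OF r1, of k]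
              by (simp add: norm_duality_map[OF smooth])
            ultimately show ?thesis using alpha(1)[OF r1] by (simp add: mult_left_mono)
          qed
          then show "\<forall>\<^sub>F k in sequentially. norm (duality_map (y (r k)) - duality_map (S (r k) (x (r k))))
              \<le> \<alpha> (r k) * (norm u + B)" by simp
          show "(\<lambda>k. \<alpha> (r k) * (norm u + B)) \<longlonglongrightarrow> 0" using tendsto_mult_left_zero[OF alpha_r] .
        qed
      qed
      moreover have "(\<lambda>k. S (r k) (x (r k)) - x (r k)) \<longlonglongrightarrow> 0"
        using LIMSEQ_subseq_LIMSEQ[OF Sz r] by (simp add: o_def z_r)
      ultimately have "(\<lambda>k. (y (r k) - S (r k) (x (r k))) + (S (r k) (x (r k)) - x (r k))) \<longlonglongrightarrow> 0 + 0"
        by (rule tendsto_add)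
      then have "(\<lambda>k. y (r k) - x (r k)) \<longlonglongrightarrow> 0" by simp
      then have "(\<lambda>k. y (r (q k)) - x (r (q k))) \<longlonglongrightarrow> 0"
        using LIMSEQ_subseq_LIMSEQ[OF _ q] by (fastforce simp: o_def)
      then have "(\<lambda>k. blinfun_apply g (y (r (q k)) - x (r (q k)))) \<longlonglongrightarrow> blinfun_apply g 0"
        by (intro tendsto_intros)
      moreover have "(\<lambda>k. blinfun_apply g (x (r (q k)))) \<longlonglongrightarrow> blinfun_apply g v"
        using v by (simp add: weakly_converges_def)
      ultimately have "(\<lambda>k. 2 * ((blinfun_apply g (y (r (q k)) - x (r (q k))) + blinfun_apply g (x (r (q k))))
          - blinfun_apply g w)) \<longlonglongrightarrow> 2 * ((blinfun_apply g 0 + blinfun_apply g v) - blinfun_apply g w)"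
        by (intro tendsto_mult tendsto_diff tendsto_add tendsto_const)
      then have "(\<lambda>k. \<beta> (r (q k))) \<longlonglongrightarrow> 2 * blinfun_apply g (v - w)"
        by (simp add: \<beta>_def blinfun.diff_right)
      then have "\<epsilon> \<le> 2 * blinfun_apply g (v - w)"
        by (rule LIMSEQ_le_const) (use large less_imp_le in blast)
      moreover have "blinfun_apply g (v - w) \<le> 0"
        unfolding g_def w_def by (rule gen_proj_variational[OF smooth uc F vF])
      ultimately show False using \<epsilon> by linarith
    qed
  qed (use alpha_lim iii in auto)
  then have "(\<lambda>n. w - x n) \<longlonglongrightarrow> 0"
    unfolding s_def
    by (rule phi_tendsto_0_imp[OF smooth uc, where M = B, rotated 2])
       (use w_B x_B in \<open>auto simp: eventually_sequentially intro!: exI[of _ 1]\<close>)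
  then have "(\<lambda>n. w - (w - x n)) \<longlonglongrightarrow> w - 0" by (intro tendsto_intros)
  then show ?thesis by simp
qed

end
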